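(* Let $n\in\mathbb{N}$ and let $E\subset\mathbb{R}^n$ be a weakly porous set with constants $0<c,\delta<1$. Then there are constants $\alpha\in(0,1)$ and $C>0$, each depending only on $n$, $c$ and $\delta$, such that $\operatorname{dist}(\cdot,E)^{-\alpha}\in A_1$ and $[\operatorname{dist}(\cdot,E)^{-\alpha}]_{A_1}\le C$.
   Context: $\mathbb{N}=\{1,2,\dots\}$; $|\cdot|$ is $n$-dimensional Lebesgue measure; $\operatorname{dist}(x,E)$ is the Euclidean distance; $\operatorname{dist}(x,E)^{-\alpha}=+\infty$ where $\operatorname{dist}(x,E)=0$. Cubes: a cube is a half-open set $Q=[a_1,b_1)\times\cdots\times[a_n,b_n)$ with all sides of equal length $\ell(Q)=b_i-a_i>0$. For a cube $P$ and $j\ge 0$, $\mathcal{D}_j(P)$ is the collection of the $2^{jn}$ pairwise disjoint half-open cubes of side length $2^{-j}\ell(P)$ whose union is $P$, and $\mathcal{D}(P)=\bigcup_{j\ge0}\mathcal{D}_j(P)$. Weak porosity: let $E\subset\mathbb{R}^n$ be nonempty. A cube $Q\in\mathcal{D}(P)$ is $E$-free if $E\cap Q=\emptyset$. $\mathcal{M}(P)\in\mathcal{D}(P)$ denotes a (fixed choice of a) largest $E$-free dyadic subcube of $P$. $E$ is weakly porous with constants $0<c,\delta<1$ if for every cube $P\subset\mathbb{R}^n$ there exist $N\in\mathbb{N}$ and pairwise disjoint $E$-free cubes $Q_1,\dots,Q_N\in\mathcal{D}(P)$ with $|Q_k|\ge\delta|\mathcal{M}(P)|$ for all $k$ and $\sum_{k=1}^N|Q_k|\ge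 c|P|$ (in particular, every cube $P$ is required to have an $E$-free dyadic subcube). A weight is a locally integrable function $w$ on $\mathbb{R}^n$ with $w>0$ almost everywhere. A weight $w$ is in $A_1=A_1(\mathbb{R}^n)$ if there is a constant $C$ such that $\frac1{|Q|}\int_Q w\,dx\le C\operatorname{ess\,inf}_{Q}w$ for every cube $Q\subset\mathbb{R}^n$; the smallest such $C$ is denoted $[w]_{A_1}$. *)

theory Defs
  imports "HOL-Analysis.Analysis"
begin

definition cube :: "real^'n \<Rightarrow> real \<Rightarrow> (real^'n) set" where
  "cube a l = {x. \<forall>i. a $ i \<le> x $ i \<and> x $ i < a $ i + l}"

definition is_cube :: "(real^'n) set \<Rightarrow> bool" where
  "is_cube Q \<longleftrightarrow> (\<exists>a l. 0 < l \<and> Q = cube a l)"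

lemma cube_inject:
  fixes a b :: "real^'n"
  assumes "0 < l" "0 < m" "cube a l = cube b m"
  shows "a = b" "l = m"
proof -
  have sub: "b $ i \<le> a $ i \<and> a $ i + l \<le> b $ i + m"
    if "0 < l" "0 < m" "cube a l = cube b m" for a b :: "real^'n" and l m i
  proof
    have "a \<in> cube a l" using that(1) by (simp add: cube_def)
    then have "a \<in> cube b m" using that(3) by simp
    then have ab: "b $ j \<le> a $ j \<and> a $ j < b $ j + m" for j
      by (simp add: cube_def)
    then show "b $ i \<le> a $ i" by blast
    show "a $ i + l \<le> b $ i + m"
    proof (rule ccontr)
      assume c: "\<not> a $ i + l \<le> b $ i + m"
      define x where "x = (\<chi> j. if j = i then b $ i + m else a $ j)"
      have "x \<in> cube a l"
        using c ab[of i] that(1) by (auto simp: x_def cube_def)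
      then have "x \<in> cube b m" using that(3) by simp
      then have "x $ i < b $ i + m" by (simp add: cube_def)
      then show False by (simp add: x_def)
    qed
  qed
  have e: "a $ i = b $ i \<and> l = m" for i
    using sub[OF assms, of i] sub[OF assms(2,1) assms(3)[symmetric], of i] by linarith
  from e show "a = b" by (simp add: vec_eq_iff)
  from e show "l = m" by blast
qed

text \<open>
  A cube determines its corner and side length by \<open>cube_inject\<close>. The lemmas below confirm that
  \<open>dyadic_gen j P\<close> consists of \<open>2 ^ (j * n)\<close> pairwise disjoint cubes with union \<open>P\<close>.
\<close>
definition dyadic_gen :: "nat \<Rightarrow> (real^'n) set \<Rightarrow> (real^'n) set set" where
  "dyadic_gen j P =
    {cube (\<chi> i. a $ i + real (k i) * (l / 2 ^ j)) (l / 2 ^ j) | a l k.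
      0 < l \<and> P = cube a l \<and> (\<forall>i. k i < 2 ^ j)}"

definition dyadic :: "(real^'n) set \<Rightarrow> (real^'n) set set" where
  "dyadic P = (\<Union>j. dyadic_gen j P)"

lemma dyadic_gen_cube:
  fixes a :: "real^'n"
  assumes "0 < l"
  shows "dyadic_gen j (cube a l) =
    (\<lambda>k. cube (\<chi> i. a $ i + real (k i) * (l / 2 ^ j)) (l / 2 ^ j)) ` {k. \<forall>i. k i < 2 ^ j}"
proof -
  have "b = a \<and> m = l" if "0 < m" "cube a l = cube b m" for b m
    using cube_inject[OF assms that] by simp
  then show ?thesis
    using assms unfolding dyadic_gen_def image_def by blast
qed

lemma grid_cube_mem:
  fixes a x :: "real^'n" and k :: "'n \<Rightarrow> nat"
  assumes "0 < s"
  shows "x \<in> cube (\<chi> i. a $ i + real (k i) * s) s \<longleftrightarrow> (\<forall>i. \<lfloor>(x $ i - a $ i) / s\<rfloor> = int (k i))"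
proof -
  have "(a $ i + real (k i) * s \<le> x $ i \<and> x $ i < a $ i + real (k i) * s + s)
      \<longleftrightarrow> \<lfloor>(x $ i - a $ i) / s\<rfloor> = int (k i)" for i
    using assms by (auto simp: floor_eq_iff field_simps)
  then show ?thesis by (simp add: cube_def)
qed

lemma dyadic_gen_disjoint: "pairwise disjnt (dyadic_gen j P)"
proof (cases "is_cube P")
  case True
  then obtain a l where P: "0 < l" "P = cube a l" by (auto simp: is_cube_def)
  then have s: "0 < l / 2 ^ j" by simp
  show ?thesis
    unfolding P(2) dyadic_gen_cube[OF P(1)] pairwise_image
  proof (rule pairwiseI, intro impI)
    fix k k' :: "'a \<Rightarrow> nat"
    let ?c = "\<lambda>k :: 'a \<Rightarrow> nat. cube (\<chi> i. a $ i + real (k i) * (l / 2 ^ j)) (l / 2 ^ j)"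
    assume ne: "?c k \<noteq> ?c k'"
    show "disjnt (?c k) (?c k')"
      unfolding disjnt_iff
    proof (intro allI notI)
      fix x assume "x \<in> ?c k \<and> x \<in> ?c k'"
      then have "int (k i) = int (k' i)" for i
        unfolding grid_cube_mem[OF s] by metis
      then have "k = k'" by (simp add: fun_eq_iff)
      with ne show False by simp
    qed
  qed
next
  case False
  then show ?thesis by (auto simp: dyadic_gen_def is_cube_def pairwise_def)
qed

lemma Union_dyadic_gen:
  fixes P :: "(real^'n) set"
  assumes "is_cube P"
  shows "\<Union>(dyadic_gen j P) = P"
proof -
  obtain a l where P: "0 < l" "P = cube a l" using assms by (auto simp: is_cube_def)
  then have s: "0 < l / 2 ^ j" by simp
  have "(\<exists>k. (\<forall>i. k i < 2 ^ j) \<and> (\<forall>i. \<lfloor>(x $ i - a $ i) / (l / 2 ^ j)\<rfloor> = int (k i)))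
      \<longleftrightarrow> x \<in> cube a l" (is "?L \<longleftrightarrow> ?R") for x
  proof -
    have *: "(a $ i \<le> x $ i \<and> x $ i < a $ i + l) \<longleftrightarrow>
        0 \<le> \<lfloor>(x $ i - a $ i) / (l / 2 ^ j)\<rfloor> \<and> \<lfloor>(x $ i - a $ i) / (l / 2 ^ j)\<rfloor> < 2 ^ j" for i
    proof -
      have "x $ i < a $ i + l \<longleftrightarrow> (x $ i - a $ i) / (l / 2 ^ j) < 2 ^ j"
        using pos_divide_less_eq[OF s, of "x $ i - a $ i" "2 ^ j"] by auto
      moreover have "a $ i \<le> x $ i \<longleftrightarrow> 0 \<le> (x $ i - a $ i) / (l / 2 ^ j)"
        using pos_le_divide_eq[OF s, of 0 "x $ i - a $ i"] by auto
      ultimately show ?thesis by (simp add: floor_less_iff)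
    qed
    show ?thesis
    proof
      assume ?L
      then obtain k where k: "\<And>i. k i < 2 ^ j" "\<And>i. \<lfloor>(x $ i - a $ i) / (l / 2 ^ j)\<rfloor> = int (k i)"
        by blast
      have "int (k i) < 2 ^ j" for i using k(1)[of i] by (metis of_nat_less_iff of_nat_numeral of_nat_power)
      then show ?R unfolding cube_def mem_Collect_eq * k(2) by simp
    next
      assume ?R
      then have R: "0 \<le> \<lfloor>(x $ i - a $ i) / (l / 2 ^ j)\<rfloor> \<and> \<lfloor>(x $ i - a $ i) / (l / 2 ^ j)\<rfloor> < 2 ^ j" for i
        unfolding cube_def mem_Collect_eq * by blast
      show ?L
        by (rule exI[of _ "\<lambda>i. nat \<lfloor>(x $ i - a $ i) / (l / 2 ^ j)\<rfloor>"])
           (use R in \<open>auto simp: nat_less_iff\<close>)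
    qed
  qed
  then show ?thesis
    unfolding P(2) dyadic_gen_cube[OF P(1)] set_eq_iff UN_iff bex_simps(7) grid_cube_mem[OF s]
    by blast
qed

lemma card_dyadic_gen:
  fixes P :: "(real^'n) set"
  assumes "is_cube P"
  shows "card (dyadic_gen j P) = 2 ^ (j * CARD('n))"
proof -
  obtain a l where P: "0 < l" "P = cube a l" using assms by (auto simp: is_cube_def)
  then have s: "0 < l / 2 ^ j" by simp
  have "inj_on (\<lambda>k. cube (\<chi> i. a $ i + real (k i) * (l / 2 ^ j)) (l / 2 ^ j)) {k. \<forall>i. k i < 2 ^ j}"
    using s by (auto simp: inj_on_def vec_eq_iff fun_eq_iff dest!: cube_inject(1)[OF s s])
  then have "card (dyadic_gen j P) = card {k :: 'n \<Rightarrow> nat. \<forall>i. k i < 2 ^ j}"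
    unfolding P(2) dyadic_gen_cube[OF P(1)] by (rule card_image)
  also have "{k :: 'n \<Rightarrow> nat. \<forall>i. k i < 2 ^ j} = PiE UNIV (\<lambda>_. {..<2 ^ j})"
    by (auto simp: PiE_def Pi_def)
  also have "card \<dots> = 2 ^ (j * CARD('n))"
    by (simp add: card_PiE power_mult)
  finally show ?thesis .
qed

definition largest_free_cube :: "(real^'n) set \<Rightarrow> (real^'n) set \<Rightarrow> (real^'n) set" where
  "largest_free_cube E P = arg_max (measure lebesgue) (\<lambda>Q. Q \<in> dyadic P \<and> E \<inter> Q = {})"

text \<open>
  If \<open>P\<close> has no \<open>E\<close>-free dyadic subcube, then \<open>largest_free_cube E P\<close> is unspecified,
  but in that case the condition below fails anyway because of \<open>N \<ge> 1\<close>.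
\<close>
definition weakly_porous :: "real \<Rightarrow> real \<Rightarrow> (real^'n) set \<Rightarrow> bool" where
  "weakly_porous c \<delta> E \<longleftrightarrow> E \<noteq> {} \<and>
    (\<forall>P. is_cube P \<longrightarrow>
      (\<exists>N::nat. \<exists>Q :: nat \<Rightarrow> (real^'n) set. 1 \<le> N \<and>
        disjoint_family_on Q {1..N} \<and>
        (\<forall>k\<in>{1..N}. Q k \<in> dyadic P \<and> E \<inter> Q k = {} \<and>
          measure lebesgue (Q k) \<ge> \<delta> * measure lebesgue (largest_free_cube E P)) \<and>
        (\<Sum>k=1..N. measure lebesgue (Q k)) \<ge> c * measure lebesgue P))"

text \<open>
  Weights take values in \<open>[0, \<infinity>]\<close>, so that \<open>dist(x, E) ^ -\<alpha> = \<infinity>\<close> is allowed; local integrability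
  makes them finite almost everywhere.
\<close>
definition weight :: "(real^'n \<Rightarrow> ennreal) \<Rightarrow> bool" where
  "weight w \<longleftrightarrow> w \<in> borel_measurable lebesgue \<and>
    (\<forall>K. compact K \<longrightarrow> (\<integral>\<^sup>+x\<in>K. w x \<partial>lebesgue) < \<infinity>) \<and>
    (AE x in lebesgue. 0 < w x)"

definition ess_inf_on :: "(real^'n) set \<Rightarrow> (real^'n \<Rightarrow> ennreal) \<Rightarrow> ennreal" where
  "ess_inf_on Q w = Sup {z. AE x in lebesgue. x \<in> Q \<longrightarrow> z \<le> w x}"

definition A1_bound :: "(real^'n \<Rightarrow> ennreal) \<Rightarrow> real \<Rightarrow> bool" where
  "A1_bound w C \<longleftrightarrow> 0 \<le> C \<and>
    (\<forall>Q. is_cube Q \<longrightarrow>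
      (\<integral>\<^sup>+x\<in>Q. w x \<partial>lebesgue) / emeasure lebesgue Q \<le> ennreal C * ess_inf_on Q w)"

definition A1 :: "(real^'n \<Rightarrow> ennreal) set" where
  "A1 = {w. weight w \<and> (\<exists>C. A1_bound w C)}"

text \<open>For \<open>w \<in> A1\<close> the set of admissible constants is nonempty and closed, so the infimum is the smallest constant.\<close>
definition A1_const :: "(real^'n \<Rightarrow> ennreal) \<Rightarrow> real" where
  "A1_const w = Inf {C. A1_bound w C}"

definition dist_weight :: "(real^'n) set \<Rightarrow> real \<Rightarrow> real^'n \<Rightarrow> ennreal" where
  "dist_weight E \<alpha> x =
    (if infdist x E = 0 then \<infinity> else ennreal (infdist x E powr (- \<alpha>)))"

end

theory Submission
  imports Defs
begin

text \<open>
  Write g(P) for the supremum of the sides of E-free cubes, dyadic or not, contained in a cube P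
  (\<open>free_side\<close>). The weight is in A_1 because \<open>g(P) powr - \<alpha>\<close> separates, up to constants, its average
  over P from its essential infimum on P, unless P is far away from E, where the weight is nearly
  constant.

  The infimum is the easy half (\<open>infdist_le_free_side\<close>): around a point at distance r from E there
  is a free cube of side about r, so no point of P is much further from E than g(P).

  For the average, weak porosity fills the fraction c of P with free cubes of side at least a
  multiple of g(P). On the central part of each of them the distance to E is at least such a
  multiple too, so there the weight is at most a constant times \<open>g(P) powr - \<alpha>\<close>. What remains has
  measure at most q |P| with q < 1, and it is a disjoint union of cubes R for which one would like to
  use the same estimate again. This costs the factor \<open>(g(P)/g(R)) powr \<alpha>\<close>, which is harmless if
  g(R) is at least \<open>\<rho>\<close> times g(P) with \<open>\<rho>\<close> depending only on n, c and \<open>\<delta>\<close>: for small \<open>\<alpha>\<close> the product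
  \<open>\<theta> = \<rho> powr (- \<alpha>) * q\<close> is below 1 and the errors form a geometric series.

  The decisive point is that such cubes R exist although the remainder of P may contain points near
  which all free cubes are tiny. It rests on a doubling property (\<open>free_side_doubling\<close>): passing from
  a cube to one of half the side inside it decreases g by at most a constant factor. Hence one
  subdivides P dyadically and stops as soon as a cube contains no selected free cube properly. A cube
  that still contains one has g at least the side of that free cube, so its children, where the
  subdivision may stop, lose no more than one doubling factor
  (\<open>emeasure_outside_free_cubes_le\<close>).

  To sum the series without iterating the decomposition, the weight is truncated. For the truncated
  weight some estimate with a finite constant K holds on all cubes up to a given size, and the
  decomposition improves K to \<open>A + \<theta> * K\<close> (\<open>truncated_integral_improve\<close>); repeating this gives the
  constant \<open>A / (1 - \<theta>)\<close>, independent of the truncation, and monotone convergence removes the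
  truncation.
\<close>

section \<open>Half-open cubes and their dyadic subcubes\<close>

lemma cube_subset_cube_iff:
  fixes a b :: "real^'n"
  assumes "0 < l"
  shows "cube a l \<subseteq> cube b m \<longleftrightarrow> (\<forall>i. b $ i \<le> a $ i \<and> a $ i + l \<le> b $ i + m)"
proof
  assume sub: "cube a l \<subseteq> cube b m"
  have a: "a \<in> cube a l" using assms by (simp add: cube_def)
  show "\<forall>i. b $ i \<le> a $ i \<and> a $ i + l \<le> b $ i + m"
  proof (intro allI conjI)
    fix i
    show "b $ i \<le> a $ i" using a sub by (auto simp: cube_def)
    show "a $ i + l \<le> b $ i + m"
    proof (rule ccontr)
      assume c: "\<not> a $ i + l \<le> b $ i + m"
      define x where "x = (\<chi> j. if j = i then max (a $ i) (b $ i + m) else a $ j)"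
      have "x \<in> cube a l"
        using c assms by (auto simp: x_def cube_def)
      then have "x $ i < b $ i + m" using sub by (auto simp: cube_def)
      then show False by (simp add: x_def)
    qed
  qed
next
  assume "\<forall>i. b $ i \<le> a $ i \<and> a $ i + l \<le> b $ i + m"
  then have "b $ i \<le> a $ i" "a $ i + l \<le> b $ i + m" for i by blast+
  then show "cube a l \<subseteq> cube b m"
    unfolding cube_def by (fastforce intro: order_trans less_le_trans)
qed

lemma sets_cube [measurable]: "cube (a :: real^'n) l \<in> sets borel"
  unfolding cube_def by measurable

lemma cube_sets_lebesgue [simp]: "cube (a :: real^'n) l \<in> sets lebesgue"
  using sets_cube by (metis sets_completionI_sets sets_lborel)

lemma cube_lmeasurable [simp]: "cube (a :: real^'n) l \<in> lmeasurable"
proof (rule bounded_set_imp_lmeasurable)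
  have "cube a l \<subseteq> cbox a (\<chi> i. a $ i + l)"
    by (auto simp: cbox_def cube_def Basis_vec_def inner_axis less_imp_le)
  then show "bounded (cube a l)" by (meson bounded_cbox bounded_subset)
qed simp

lemma measure_le_box_volume:
  fixes u v :: "real^'n"
  assumes "\<And>i. u $ i \<le> v $ i" "S \<subseteq> {x. \<forall>i. u $ i \<le> x $ i \<and> x $ i \<le> v $ i}" "S \<in> sets lebesgue"
  shows "measure lebesgue S \<le> (\<Prod>i\<in>UNIV. v $ i - u $ i)"
proof -
  have "measure lebesgue S \<le> measure lebesgue (cbox u v)"
    by (rule measure_mono_fmeasurable) (use assms in \<open>auto simp: mem_box_cart\<close>)
  also have "\<dots> = (\<Prod>i\<in>UNIV. v $ i - u $ i)"
    using content_cbox_cart[of u v] assms(1) by (auto simp: box_ne_empty Basis_vec_def inner_axis)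
  finally show ?thesis .
qed

lemma measure_cube:
  fixes a :: "real^'n"
  assumes "0 \<le> l"
  shows "measure lebesgue (cube a l) = l ^ CARD('n)" "measure lborel (cube a l) = l ^ CARD('n)"
proof -
  show "measure lebesgue (cube a l) = l ^ CARD('n)"
  proof (rule antisym)
    define b where "b = (\<chi> i. a $ i + l)"
    have e: "(\<Prod>i\<in>UNIV. b $ i - a $ i) = l ^ CARD('n)" by (simp add: b_def)
    show "measure lebesgue (cube a l) \<le> l ^ CARD('n)"
      unfolding e[symmetric] by (rule measure_le_box_volume) (use assms in \<open>auto simp: b_def cube_def less_imp_le\<close>)
    have "l ^ CARD('n) = measure lebesgue (cbox a b)"
      using content_cbox_cart[of a b] assms e by (auto simp: box_ne_empty Basis_vec_def inner_axis b_def)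
    also have "\<dots> = measure lebesgue (box a b)"
      by (simp add: measure_completion measure_lborel_box_eq measure_lborel_cbox_eq)
    also have "\<dots> \<le> measure lebesgue (cube a l)"
    proof (rule measure_mono_fmeasurable)
      show "box a b \<subseteq> cube a l"
        by (auto simp: box_def cube_def b_def Basis_vec_def inner_axis less_imp_le)
      show "cube a l \<in> lmeasurable" by (rule cube_lmeasurable)
    qed auto
    finally show "l ^ CARD('n) \<le> measure lebesgue (cube a l)" .
  qed
  then show "measure lborel (cube a l) = l ^ CARD('n)" by (simp add: measure_completion)
qed

lemma emeasure_cube:
  fixes a :: "real^'n"
  assumes "0 \<le> l"
  shows "emeasure lebesgue (cube a l) = ennreal (l ^ CARD('n))"
  using measure_cube(1)[OF assms] by (metis cube_lmeasurable emeasure_eq_measure2)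

lemma dyadicE:
  fixes a :: "real^'n"
  assumes "Q \<in> dyadic (cube a l)" "0 < l"
  obtains b j where "Q = cube b (l / 2 ^ j)" "Q \<in> dyadic_gen j (cube a l)"
  using assms by (auto simp: dyadic_def dyadic_gen_cube)

lemma dyadic_gen_subset: "Q \<in> dyadic_gen j P \<Longrightarrow> Q \<subseteq> P"
  using Union_dyadic_gen[of P j] unfolding dyadic_gen_def is_cube_def by blast

lemma dyadic_gen_0 [simp]:
  fixes a :: "real^'n"
  assumes "0 < l"
  shows "dyadic_gen 0 (cube a l) = {cube a l}"
proof -
  have "{k :: 'n \<Rightarrow> nat. \<forall>i. k i = 0} = {\<lambda>_. 0}" by auto
  then show ?thesis using assms by (auto simp: dyadic_gen_cube)
qed

text \<open>
  In one coordinate, the position among \<open>2 ^ Suc j\<close> is written in base \<open>2 ^ j\<close>: the leading digit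
  selects the child, the remainder the place inside the child.
\<close>

lemma dyadic_gen_descend:
  fixes a :: "real^'n"
  assumes "0 < l" "Q \<in> dyadic_gen (Suc j) (cube a l)"
  obtains R where "R \<in> dyadic_gen 1 (cube a l)" "Q \<in> dyadic_gen j R"
proof -
  obtain k where k: "\<And>i. k i < 2 ^ Suc j"
    and Q: "Q = cube (\<chi> i. a $ i + real (k i) * (l / 2 ^ Suc j)) (l / 2 ^ Suc j)"
    using assms by (auto simp: dyadic_gen_cube)
  define p where "p i = k i div 2 ^ j" for i
  define r where "r i = k i mod 2 ^ j" for i
  define R where "R = cube (\<chi> i. a $ i + real (p i) * (l / 2 ^ 1)) (l / 2 ^ 1)"
  have "p i < 2 ^ 1" for i using k[of i] by (simp add: p_def less_mult_imp_div_less)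
  then have R: "R \<in> dyadic_gen 1 (cube a l)"
    unfolding R_def dyadic_gen_cube[OF assms(1)] by blast
  have kk: "real (k i) = real (p i) * 2 ^ j + real (r i)" for i
  proof -
    have "k i = p i * 2 ^ j + r i" by (simp only: p_def r_def div_mult_mod_eq)
    then show ?thesis by (simp only: of_nat_add of_nat_mult of_nat_power of_nat_numeral)
  qed
  have "Q = cube (\<chi> i. (\<chi> i. a $ i + real (p i) * (l / 2 ^ 1)) $ i + real (r i) * (l / 2 ^ 1 / 2 ^ j)) (l / 2 ^ 1 / 2 ^ j)"
    unfolding Q kk by (simp add: field_simps)
  moreover have "r i < 2 ^ j" for i by (simp add: r_def)
  ultimately have "Q \<in> dyadic_gen j R"
    unfolding R_def using assms(1) by (subst dyadic_gen_cube) auto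
  with R that show ?thesis by blast
qed

lemma dyadic_trans:
  fixes a :: "real^'n"
  assumes "0 < l" "Q \<in> dyadic (cube a l)" "R \<in> dyadic Q"
  shows "R \<in> dyadic (cube a l)"
proof -
  obtain j k where k: "\<And>i. k i < 2 ^ j"
    and Q: "Q = cube (\<chi> i. a $ i + real (k i) * (l / 2 ^ j)) (l / 2 ^ j)"
    using assms(1,2) by (auto simp: dyadic_def dyadic_gen_cube)
  have "0 < l / 2 ^ j" using assms(1) by simp
  then obtain m h where h: "\<And>i. h i < 2 ^ m"
    and R: "R = cube (\<chi> i. a $ i + real (k i) * (l / 2 ^ j) + real (h i) * (l / 2 ^ j / 2 ^ m)) (l / 2 ^ j / 2 ^ m)"
    using assms(3) unfolding Q by (auto simp: dyadic_def dyadic_gen_cube)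
  have "h i + k i * 2 ^ m < 2 ^ (j + m)" for i
  proof -
    have "h i + k i * 2 ^ m < (k i + 1) * 2 ^ m" using h[of i] by simp
    also have "\<dots> \<le> 2 ^ j * 2 ^ m" using k[of i] by (intro mult_right_mono) auto
    finally show ?thesis by (simp add: power_add)
  qed
  moreover have "R = cube (\<chi> i. a $ i + real (h i + k i * 2 ^ m) * (l / 2 ^ (j + m))) (l / 2 ^ (j + m))"
    unfolding R by (simp add: power_add field_simps)
  ultimately have "R \<in> dyadic_gen (j + m) (cube a l)"
    unfolding dyadic_gen_cube[OF assms(1)]
    by (intro image_eqI[where x = "\<lambda>i. h i + k i * 2 ^ m"]) auto
  then show ?thesis by (auto simp: dyadic_def)
qed

text \<open>
  A grid of mesh at most s / 2 has a full cell in every interval of length s; the first dyadic mesh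
  with this property still exceeds s / 4. This makes dyadic and arbitrary free cubes interchangeable
  up to a factor 4.
\<close>

lemma ex_dyadic_in_subcube:
  fixes a b :: "real^'n"
  assumes "0 < s" "cube b s \<subseteq> cube a l"
  obtains d t where "cube d t \<in> dyadic (cube a l)" "cube d t \<subseteq> cube b s" "s / 4 \<le> t"
proof -
  have ab: "a $ i \<le> b $ i" "b $ i + s \<le> a $ i + l" for i
    using assms by (auto simp: cube_subset_cube_iff)
  have sl: "s \<le> l" using ab[of undefined] by linarith
  then have l: "0 < l" using assms by linarith
  define j where "j = (LEAST j. l / 2 ^ j \<le> s / 2)"
  obtain j0 where "2 * l / s < 2 ^ j0" using real_arch_pow[of 2 "2 * l / s"] by auto
  then have "l / 2 ^ j0 \<le> s / 2" using assms(1) by (simp add: field_simps)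
  then have j: "l / 2 ^ j \<le> s / 2" unfolding j_def by (rule LeastI)
  have "j \<noteq> 0" using j sl assms(1) by (intro notI) simp
  then obtain i where i: "j = Suc i" by (cases j) auto
  have "\<not> l / 2 ^ i \<le> s / 2" using not_less_Least[of i "\<lambda>j. l / 2 ^ j \<le> s / 2"] i j_def by auto
  then have "s / 4 \<le> (l / 2 ^ i) / 2" using divide_right_mono[of "s / 2" "l / 2 ^ i" 2] by simp
  then have lower: "s / 4 \<le> l / 2 ^ j" unfolding i by (simp add: mult.commute)
  define t where "t = l / 2 ^ j"
  have t: "0 < t" "t \<le> s / 2" using l j by (auto simp: t_def)
  define k where "k i = nat \<lceil>(b $ i - a $ i) / t\<rceil>" for i
  have "0 \<le> (b $ i - a $ i) / t" for i using ab t by simp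
  then have rk: "real (k i) = \<lceil>(b $ i - a $ i) / t\<rceil>" for i
    unfolding k_def by (metis ceiling_mono ceiling_zero of_nat_nat)
  have k1: "b $ i - a $ i \<le> real (k i) * t" for i
    unfolding rk using iffD1[OF pos_divide_le_eq[OF t(1)] le_of_int_ceiling] .
  have k2: "real (k i) * t < b $ i - a $ i + t" for i
  proof -
    have "real (k i) < (b $ i - a $ i) / t + 1" unfolding rk by linarith
    then have "real (k i) * t < ((b $ i - a $ i) / t + 1) * t" using t(1) by (rule mult_strict_right_mono)
    also have "\<dots> = b $ i - a $ i + t" using t by (simp add: distrib_right)
    finally show ?thesis .
  qed
  have "k i < 2 ^ j" for i
  proof -
    have "real (k i) * t < l" using k2[of i] ab(2)[of i] t by linarith
    then have "real (k i) < 2 ^ j" using l by (simp add: t_def field_simps)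
    then show ?thesis by (metis of_nat_less_iff of_nat_numeral of_nat_power)
  qed
  then have "cube (\<chi> i. a $ i + real (k i) * t) t \<in> dyadic (cube a l)"
    unfolding dyadic_def t_def using dyadic_gen_cube[OF l] by blast
  moreover have "cube (\<chi> i. a $ i + real (k i) * t) t \<subseteq> cube b s"
    unfolding cube_subset_cube_iff[OF t(1)]
  proof (intro allI conjI)
    fix i
    show "b $ i \<le> (\<chi> i. a $ i + real (k i) * t) $ i" using k1[of i] by simp
    show "(\<chi> i. a $ i + real (k i) * t) $ i + t \<le> b $ i + s" using k2[of i] t by simp
  qed
  ultimately show ?thesis using that lower t_def by blast
qed

section \<open>The largest free cube inside a cube\<close>

text \<open>
  The cubes in the supremum need not be dyadic subcubes of P. Therefore the quantity is monotone in P
  for arbitrary inclusions of cubes, as the doubling argument requires, where the cubes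
  belong to no common grid.
\<close>

definition free_side :: "(real^'n) set \<Rightarrow> (real^'n) set \<Rightarrow> real" where
  "free_side E P = Sup {s. 0 < s \<and> (\<exists>b. cube b s \<subseteq> P \<and> E \<inter> cube b s = {})}"

text \<open>
  Weak porosity with side lengths in place of volumes and with \<open>free_side\<close> in place of the largest
  dyadic free cube.
\<close>

definition evenly_porous :: "real \<Rightarrow> real \<Rightarrow> (real^'n) set \<Rightarrow> bool" where
  "evenly_porous c \<eta> E \<longleftrightarrow>
    (\<forall>a l. 0 < l \<longrightarrow> (\<exists>\<Q>. finite \<Q> \<and> \<Q> \<subseteq> dyadic (cube a l) \<and> disjoint \<Q> \<and>
      (\<forall>Q\<in>\<Q>. E \<inter> Q = {} \<and> (\<exists>b s. 0 < s \<and> \<eta> * free_side E (cube a l) \<le> s \<and> Q = cube b s)) \<and>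
      c * measure lebesgue (cube a l) \<le> measure lebesgue (\<Union>\<Q>)))"

lemma free_side_bdd:
  fixes a :: "real^'n"
  shows "bdd_above {s. 0 < s \<and> (\<exists>b. cube b s \<subseteq> cube a l \<and> E \<inter> cube b s = {})}"
proof (rule bdd_aboveI)
  fix s assume "s \<in> {s. 0 < s \<and> (\<exists>b. cube b s \<subseteq> cube a l \<and> E \<inter> cube b s = {})}"
  then obtain b where "0 < s" "cube b s \<subseteq> cube a l" by blast
  then have "a $ i \<le> b $ i \<and> b $ i + s \<le> a $ i + l" for i by (simp add: cube_subset_cube_iff)
  from this[of undefined] show "s \<le> l" by linarith
qed

lemma free_side_ge:
  fixes a :: "real^'n"
  assumes "0 < s" "cube b s \<subseteq> cube a l" "E \<inter> cube b s = {}"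
  shows "s \<le> free_side E (cube a l)"
  unfolding free_side_def by (rule cSup_upper[OF _ free_side_bdd]) (use assms in blast)

lemma evenly_porous_ex_free:
  fixes a :: "real^'n"
  assumes "evenly_porous c \<eta> E" "0 < c" "0 < l"
  obtains b s where "0 < s" "cube b s \<subseteq> cube a l" "E \<inter> cube b s = {}"
proof -
  obtain \<Q> where Q: "\<Q> \<subseteq> dyadic (cube a l)"
      "\<And>Q. Q \<in> \<Q> \<Longrightarrow> E \<inter> Q = {} \<and> (\<exists>b s. 0 < s \<and> Q = cube b s)"
      "c * measure lebesgue (cube a l) \<le> measure lebesgue (\<Union>\<Q>)"
    using assms(1,3) unfolding evenly_porous_def by meson
  have "0 < c * measure lebesgue (cube a l)" using assms by (simp add: measure_cube)
  with Q(3) have "\<Q> \<noteq> {}" by auto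
  then obtain R where R: "R \<in> \<Q>" by blast
  obtain b s where "0 < s" "R = cube b s" using Q(2)[OF R] by blast
  moreover have "R \<subseteq> cube a l" using Q(1) R unfolding dyadic_def by (blast dest: dyadic_gen_subset)
  ultimately show ?thesis using that Q(2)[OF R] by blast
qed

lemma free_side_le:
  fixes a :: "real^'n"
  assumes "evenly_porous c \<eta> E" "0 < c" "0 < l"
    and "\<And>s b. 0 < s \<Longrightarrow> cube b s \<subseteq> cube a l \<Longrightarrow> E \<inter> cube b s = {} \<Longrightarrow> s \<le> u"
  shows "free_side E (cube a l) \<le> u"
  unfolding free_side_def
proof (rule cSup_least)
  show "{s. 0 < s \<and> (\<exists>b. cube b s \<subseteq> cube a l \<and> E \<inter> cube b s = {})} \<noteq> {}"
  proof -
    obtain s and b :: "real^'n" where "0 < s" "cube b s \<subseteq> cube a l" "E \<inter> cube b s = {}"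
      by (rule evenly_porous_ex_free[OF assms(1-3)])
    then show ?thesis by blast
  qed
qed (use assms(4) in blast)

lemma free_side_pos:
  fixes a :: "real^'n"
  assumes "evenly_porous c \<eta> E" "0 < c" "0 < l"
  shows "0 < free_side E (cube a l)"
proof -
  obtain s and b :: "real^'n" where "0 < s" "cube b s \<subseteq> cube a l" "E \<inter> cube b s = {}"
    by (rule evenly_porous_ex_free[OF assms])
  then show ?thesis using free_side_ge[of s b a l E] by linarith
qed

lemma free_side_le_side:
  fixes a :: "real^'n"
  assumes "evenly_porous c \<eta> E" "0 < c" "0 < l"
  shows "free_side E (cube a l) \<le> l"
proof (rule free_side_le[OF assms])
  fix s and b :: "real^'n" assume "0 < s" "cube b s \<subseteq> cube a l"
  then have "a $ i \<le> b $ i \<and> b $ i + s \<le> a $ i + l" for i by (simp add: cube_subset_cube_iff)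
  from this[of undefined] show "s \<le> l" by linarith
qed

text \<open>
  The sides of the dyadic subcubes are \<open>l / 2 ^ j\<close>, so a free cube of the lowest generation that has
  one attains the maximum.
\<close>

lemma largest_free_cube_maximal:
  fixes a :: "real^'n"
  assumes "0 < l" "Q \<in> dyadic (cube a l)" "E \<inter> Q = {}"
  shows "largest_free_cube E (cube a l) \<in> dyadic (cube a l)"
    and "measure lebesgue Q \<le> measure lebesgue (largest_free_cube E (cube a l))"
proof -
  let ?P = "\<lambda>Q. Q \<in> dyadic (cube a l) \<and> E \<inter> Q = {}"
  let ?J = "\<lambda>j. \<exists>Q \<in> dyadic_gen j (cube a l). E \<inter> Q = {}"
  have meas: "measure lebesgue Q = (l / 2 ^ j) ^ CARD('n)" if "Q \<in> dyadic_gen j (cube a l)" for Q j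
    using that assms(1) by (auto simp: dyadic_gen_cube measure_cube)
  define j where "j = (LEAST j. ?J j)"
  have ex: "\<exists>j. ?J j" using assms(2,3) by (auto simp: dyadic_def)
  have "?J j" unfolding j_def by (rule LeastI_ex[OF ex])
  then obtain M where M: "M \<in> dyadic_gen j (cube a l)" "E \<inter> M = {}" by blast
  have PM: "?P M" using M by (auto simp: dyadic_def)
  have max: "measure lebesgue R \<le> measure lebesgue M" if R: "?P R" for R
  proof -
    obtain i where i: "R \<in> dyadic_gen i (cube a l)" using R by (auto simp: dyadic_def)
    then have "j \<le> i" unfolding j_def using R by (intro Least_le) blast
    then have "l / 2 ^ i \<le> l / 2 ^ j" using assms(1) by (intro divide_left_mono) auto
    then show ?thesis using meas[OF i] meas[OF M(1)] assms(1) by (simp add: power_mono)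
  qed
  have "?P (largest_free_cube E (cube a l)) \<and>
      (\<forall>R. ?P R \<longrightarrow> \<not> measure lebesgue R > measure lebesgue (largest_free_cube E (cube a l)))"
    unfolding largest_free_cube_def
    by (rule arg_maxI[where x = M]) (use PM max in \<open>auto simp: not_less\<close>)
  then show "largest_free_cube E (cube a l) \<in> dyadic (cube a l)"
    and "measure lebesgue Q \<le> measure lebesgue (largest_free_cube E (cube a l))"
    using assms(2,3) by (auto simp: not_less)
qed

text \<open>
  The condition on volumes gives side at least \<open>\<delta> powr (1/n)\<close> times that of the largest dyadic free
  cube, and \<open>\<delta>\<close> is the smaller of the two factors since \<open>\<delta> < 1\<close>. The factor 1/4 comes from
  \<open>ex_dyadic_in_subcube\<close>.
\<close>

lemma weakly_porous_imp_evenly_porous: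
  fixes E :: "(real^'n) set"
  assumes "weakly_porous c \<delta> E" "0 < c" "0 < \<delta>" "\<delta> < 1"
  shows "evenly_porous c (\<delta> / 4) E"
  unfolding evenly_porous_def
proof (intro allI impI)
  fix a :: "real^'n" and l :: real assume l: "0 < l"
  let ?P = "cube a l"
  let ?n = "CARD('n)"
  obtain N :: nat and Q where Q: "disjoint_family_on Q {1..N}" "1 \<le> N"
    "\<And>k. k \<in> {1..N} \<Longrightarrow> Q k \<in> dyadic ?P \<and> E \<inter> Q k = {} \<and>
          measure lebesgue (Q k) \<ge> \<delta> * measure lebesgue (largest_free_cube E ?P)"
    "(\<Sum>k=1..N. measure lebesgue (Q k)) \<ge> c * measure lebesgue ?P"
    using assms(1) l unfolding weakly_porous_def is_cube_def by metis
  have Q1: "Q 1 \<in> dyadic ?P" "E \<inter> Q 1 = {}" using Q(2,3) by auto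
  obtain d t where M: "largest_free_cube E ?P = cube d t" "0 < t"
    using dyadicE[OF largest_free_cube_maximal(1)[OF l Q1] l] l by (metis divide_pos_pos zero_less_numeral zero_less_power)
  have side: "\<delta> / 4 * free_side E ?P \<le> s" if k: "k \<in> {1..N}" and "0 < s" "Q k = cube b s" for k b s
  proof -
    have "\<delta> * t ^ ?n \<le> s ^ ?n"
      using Q(3)[OF k] that M by (simp add: measure_cube)
    moreover have "\<delta> ^ ?n \<le> \<delta>"
      using assms(3,4) power_decreasing[of 1 ?n \<delta>] by (simp add: Suc_leI)
    moreover have "0 \<le> t ^ ?n" using M(2) by simp
    ultimately have "\<delta> ^ ?n * t ^ ?n \<le> s ^ ?n"
      using mult_right_mono[of "\<delta> ^ ?n" \<delta> "t ^ ?n"] by linarith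
    then have "(\<delta> * t) ^ ?n \<le> s ^ ?n" by (simp only: power_mult_distrib)
    then have st: "\<delta> * t \<le> s"
      using that(2) by (meson less_eq_real_def not_le power_strict_mono zero_less_card_finite)
    have "free_side E ?P \<le> 4 * t"
      unfolding free_side_def
    proof (rule cSup_least)
      show "{s. 0 < s \<and> (\<exists>b. cube b s \<subseteq> ?P \<and> E \<inter> cube b s = {})} \<noteq> {}"
        using that k Q(3)[OF k] dyadic_gen_subset unfolding dyadic_def by blast
      fix r assume "r \<in> {s. 0 < s \<and> (\<exists>b. cube b s \<subseteq> ?P \<and> E \<inter> cube b s = {})}"
      then obtain b where r: "0 < r" "cube b r \<subseteq> ?P" "E \<inter> cube b r = {}" by blast
      obtain e u where u: "cube e u \<in> dyadic ?P" "cube e u \<subseteq> cube b r" "r / 4 \<le> u"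
        using ex_dyadic_in_subcube[OF r(1,2)] by blast
      have "E \<inter> cube e u = {}" using u(2) r(3) by blast
      from largest_free_cube_maximal(2)[OF l u(1) this] have "u ^ ?n \<le> t ^ ?n"
        using M u(3) r(1) by (simp add: measure_cube)
      then have "u \<le> t"
        using M(2) by (meson less_eq_real_def not_le power_strict_mono zero_less_card_finite)
      then show "r \<le> 4 * t" using u(3) by linarith
    qed
    then have "\<delta> * free_side E ?P \<le> \<delta> * (4 * t)" using assms(3) by (intro mult_left_mono) auto
    then show ?thesis using st by simp
  qed
  let ?F = "Q ` {1..N}"
  have cubes: "\<exists>b s. 0 < s \<and> Q k = cube b s" if "k \<in> {1..N}" for k
  proof -
    have "Q k \<in> dyadic ?P" using Q(3)[OF that] by blast
    from dyadicE[OF this l] obtain b j where "Q k = cube b (l / 2 ^ j)" by blast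
    then show ?thesis using l by (intro exI[of _ b] exI[of _ "l / 2 ^ j"]) simp
  qed
  then have lm: "Q k \<in> lmeasurable" if "k \<in> {1..N}" for k using that by fastforce
  have "measure lebesgue (\<Union>?F) = (\<Sum>k=1..N. measure lebesgue (Q k))"
  proof (rule measure_finite_Union)
    show "Q ` {1..N} \<subseteq> sets lebesgue" using fmeasurableD[OF lm] by blast
    show "emeasure lebesgue (Q k) \<noteq> \<infinity>" if "k \<in> {1..N}" for k
      unfolding infinity_ennreal_def by (rule fmeasurableD2[OF lm[OF that]])
  qed (use Q(1) in auto)
  then have "c * measure lebesgue ?P \<le> measure lebesgue (\<Union>?F)" using Q(4) by simp
  moreover have "\<exists>b s. 0 < s \<and> \<delta> / 4 * free_side E ?P \<le> s \<and> Q k = cube b s" if "k \<in> {1..N}" for k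
    using cubes[OF that] side[OF that] by blast
  moreover have "disjoint ?F"
  proof (rule disjointI)
    fix R S assume "R \<in> ?F" "S \<in> ?F" "R \<noteq> S"
    then obtain i j where "i \<in> {1..N}" "j \<in> {1..N}" "R = Q i" "S = Q j" "i \<noteq> j" by blast
    then show "R \<inter> S = {}" using Q(1) unfolding disjoint_family_on_def by metis
  qed
  ultimately show "\<exists>\<Q>. finite \<Q> \<and> \<Q> \<subseteq> dyadic ?P \<and> disjoint \<Q> \<and>
      (\<forall>Q\<in>\<Q>. E \<inter> Q = {} \<and> (\<exists>b s. 0 < s \<and> \<delta> / 4 * free_side E ?P \<le> s \<and> Q = cube b s)) \<and>
      c * measure lebesgue ?P \<le> measure lebesgue (\<Union>\<Q>)"
    using Q(3) by (intro exI[of _ ?F]) auto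
qed

section \<open>Doubling\<close>

text \<open>
  The intersection is a box with sides at most s. If one of its sides were below \<open>\<kappa> * s\<close>, its volume
  would be below \<open>\<kappa> * s ^ n\<close>; so all sides are at least \<open>\<kappa> * s\<close>.
\<close>

lemma subcube_of_fat_intersection:
  fixes a b :: "real^'n"
  assumes "0 < s" "0 < \<kappa>" "\<kappa> * s ^ CARD('n) \<le> measure lebesgue (cube b s \<inter> cube a l)"
  obtains d where "cube d (\<kappa> * s) \<subseteq> cube b s \<inter> cube a l"
proof -
  define u where "u = (\<chi> i. max (b $ i) (a $ i))"
  define v where "v = (\<chi> i. max (u $ i) (min (b $ i + s) (a $ i + l)))"
  have le: "measure lebesgue (cube b s \<inter> cube a l) \<le> (\<Prod>i\<in>UNIV. v $ i - u $ i)"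
    by (rule measure_le_box_volume)
      (auto simp: u_def v_def cube_def less_imp_le intro!: max.coboundedI2 min.boundedI)
  have vs: "v $ i - u $ i \<le> s" for i using assms(1) by (auto simp: u_def v_def)
  have nn: "0 \<le> v $ i - u $ i" for i by (auto simp: v_def)
  have wide: "\<kappa> * s \<le> v $ i - u $ i" for i
  proof (rule ccontr)
    assume thin: "\<not> \<kappa> * s \<le> v $ i - u $ i"
    have "(\<Prod>i\<in>UNIV. v $ i - u $ i) = (v $ i - u $ i) * (\<Prod>j\<in>UNIV - {i}. v $ j - u $ j)"
      by (rule prod.remove) auto
    also have "\<dots> \<le> (v $ i - u $ i) * (\<Prod>j\<in>UNIV - {i}. s)"
      by (intro mult_left_mono prod_mono) (use vs nn in auto)
    also have "(\<Prod>j\<in>UNIV - {i}. s) = s ^ (CARD('n) - 1)" by simp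
    also have "(v $ i - u $ i) * s ^ (CARD('n) - 1) < \<kappa> * s * s ^ (CARD('n) - 1)"
      by (intro mult_strict_right_mono) (use thin assms in auto)
    also have "\<dots> = \<kappa> * s ^ CARD('n)"
      by (metis mult.assoc power_minus_mult zero_less_card_finite mult.commute)
    finally show False using le assms(3) by linarith
  qed
  have pos: "0 < \<kappa> * s" using assms by simp
  have "cube u (\<kappa> * s) \<subseteq> cube b s" "cube u (\<kappa> * s) \<subseteq> cube a l"
    unfolding cube_subset_cube_iff[OF pos]
    using wide pos by (auto simp: u_def v_def split: if_splits) (smt (verit, best))+
  then show ?thesis using that by blast
qed

text \<open>
  The larger cube R contains free cubes of total volume at least c|R|, and R - P has volume at most
  c|R|/2. So half of their volume lies in P, and by averaging one free cube Q has at least the fraction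
  c/2 of its volume in P. Then P contains a free cube of side at least c/2 times that of Q.
\<close>

lemma free_side_slight_enlargement:
  fixes a b :: "real^'n"
  assumes porous: "evenly_porous c \<eta> E" "0 < c"
    and "0 < l" "l \<le> m" "cube a l \<subseteq> cube b m" "(1 - c / 2) * m ^ CARD('n) \<le> l ^ CARD('n)"
  shows "c * \<eta> / 2 * free_side E (cube b m) \<le> free_side E (cube a l)"
proof -
  let ?P = "cube a l" and ?R = "cube b m"
  have m: "0 < m" using assms by linarith
  obtain \<Q> where Q: "finite \<Q>" "\<Q> \<subseteq> dyadic ?R" "disjoint \<Q>"
      "\<And>Q. Q \<in> \<Q> \<Longrightarrow> E \<inter> Q = {} \<and> (\<exists>b s. 0 < s \<and> \<eta> * free_side E ?R \<le> s \<and> Q = cube b s)"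
      "c * measure lebesgue ?R \<le> measure lebesgue (\<Union>\<Q>)"
    using assms(1) m unfolding evenly_porous_def by meson
  have lm: "Q \<in> lmeasurable" if "Q \<in> \<Q>" for Q using Q(4)[OF that] by auto
  have sub: "Q \<subseteq> ?R" if "Q \<in> \<Q>" for Q using Q(2) that unfolding dyadic_def by (blast dest: dyadic_gen_subset)
  have Ulm: "\<Union>\<Q> \<in> lmeasurable" using lm Q(1) by (intro fmeasurable.finite_Union) auto
  have "measure lebesgue (\<Union>\<Q>) \<le> measure lebesgue ((\<Union>\<Q> \<inter> ?P) \<union> (?R - ?P))"
    by (rule measure_mono_fmeasurable) (use sub Ulm in \<open>auto simp: fmeasurableD intro!: fmeasurable.Un fmeasurable.Diff fmeasurable.Int\<close>)
  also have "\<dots> \<le> measure lebesgue (\<Union>\<Q> \<inter> ?P) + measure lebesgue (?R - ?P)"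
    by (rule measure_Un_le) (use Ulm in \<open>auto simp: fmeasurableD\<close>)
  also have "measure lebesgue (?R - ?P) = m ^ CARD('n) - l ^ CARD('n)"
    using assms(3,5) m by (subst measurable_measure_Diff) (auto simp: measure_cube)
  also have "m ^ CARD('n) - l ^ CARD('n) \<le> c / 2 * measure lebesgue ?R"
    using assms(6) m by (simp add: measure_cube algebra_simps)
  also have "c / 2 * measure lebesgue ?R \<le> measure lebesgue (\<Union>\<Q>) / 2" using Q(5) by simp
  finally have half: "c / 2 * measure lebesgue ?R \<le> measure lebesgue (\<Union>\<Q> \<inter> ?P)" using Q(5) by simp
  have U: "measure lebesgue (\<Union>\<Q>) = (\<Sum>Q\<in>\<Q>. measure lebesgue Q)"
    using measure_Union'[of \<Q> lebesgue] Q(1,3) lm by (simp add: disjoint_def pairwise_def disjnt_def)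
  have "\<exists>Q\<in>\<Q>. c / 2 * measure lebesgue Q \<le> measure lebesgue (Q \<inter> ?P)"
  proof (rule ccontr)
    assume thin: "\<not> ?thesis"
    have "0 < c * measure lebesgue ?R" using assms m by (simp add: measure_cube)
    with Q(5) have "\<Q> \<noteq> {}" by auto
    have "\<Union>\<Q> \<inter> ?P = (\<Union>Q\<in>\<Q>. Q \<inter> ?P)" by blast
    then have "measure lebesgue (\<Union>\<Q> \<inter> ?P) \<le> (\<Sum>Q\<in>\<Q>. measure lebesgue (Q \<inter> ?P))"
      using measure_UNION_le[of \<Q> "\<lambda>Q. Q \<inter> ?P" lebesgue, OF Q(1)] lm
      by (metis (no_types, lifting) cube_sets_lebesgue fmeasurableD sets.Int)
    also have "\<dots> < (\<Sum>Q\<in>\<Q>. c / 2 * measure lebesgue Q)"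
      by (rule sum_strict_mono) (use thin Q(1) \<open>\<Q> \<noteq> {}\<close> in \<open>auto simp: not_le\<close>)
    also have "\<dots> = c / 2 * measure lebesgue (\<Union>\<Q>)" by (simp add: U sum_distrib_left)
    also have "\<dots> \<le> c / 2 * measure lebesgue ?R"
      using assms(2) sub Ulm by (intro mult_left_mono measure_mono_fmeasurable) (auto simp: fmeasurableD)
    finally show False using half by simp
  qed
  then obtain Q where QQ: "Q \<in> \<Q>" "c / 2 * measure lebesgue Q \<le> measure lebesgue (Q \<inter> ?P)" by blast
  obtain d s where s: "0 < s" "\<eta> * free_side E ?R \<le> s" "Q = cube d s" "E \<inter> Q = {}"
    using Q(4)[OF QQ(1)] by blast
  have "c / 2 * s ^ CARD('n) \<le> measure lebesgue (cube d s \<inter> ?P)"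
    using QQ(2) s by (simp add: measure_cube)
  then obtain e where e: "cube e (c / 2 * s) \<subseteq> cube d s \<inter> ?P"
    using subcube_of_fat_intersection[of s "c / 2" d a l] s(1) assms(2) by auto
  have "c / 2 * s \<le> free_side E ?P"
    by (rule free_side_ge[of _ e]) (use e s assms(2) in auto)
  moreover have "c / 2 * (\<eta> * free_side E ?R) \<le> c / 2 * s"
    using s(2) assms(2) by (intro mult_left_mono) auto
  ultimately show ?thesis by (simp add: mult.assoc)
qed

text \<open>
  Weak porosity of the large cube alone does not help, since its free cubes may all avoid
  the small one. The small cube is instead enlarged to the large one in m steps, each so slight that
  \<open>free_side_slight_enlargement\<close> applies; m depends only on n and c.
\<close>

lemma free_side_doubling:
  assumes "0 < c" "0 < \<eta>" "\<eta> < 1" "c < 1"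
  obtains \<sigma> :: real where "0 < \<sigma>" "\<sigma> \<le> 1"
    "\<And>E (a :: real^'n) b l. evenly_porous c \<eta> E \<Longrightarrow> 0 < l \<Longrightarrow> cube a l \<subseteq> cube b (2 * l) \<Longrightarrow>
      \<sigma> * free_side E (cube b (2 * l)) \<le> free_side E (cube a l)"
proof -
  let ?n = "CARD('n)"
  obtain m :: nat where m: "real m > 2 * real ?n / c" using reals_Archimedean2 by blast
  have "0 < 2 * real ?n / c" using assms by simp
  then have m0: "0 < real m" using m by linarith
  define \<tau> where "\<tau> = c * \<eta> / 2"
  have "c * \<eta> < 1 * 1" using assms by (intro mult_strict_mono) auto
  then have \<tau>: "0 < \<tau>" "\<tau> \<le> 1" using assms by (auto simp: \<tau>_def)
  show ?thesis
  proof
    show "0 < \<tau> ^ m" "\<tau> ^ m \<le> 1" using \<tau> by (auto intro: power_le_one)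
    fix E :: "(real^'n) set" and a b :: "real^'n" and l :: real
    assume porous: "evenly_porous c \<eta> E" and l: "0 < l" and sub: "cube a l \<subseteq> cube b (2 * l)"
    have ab: "b $ i \<le> a $ i" "a $ i \<le> b $ i + l" for i
      using sub by (auto simp: cube_subset_cube_iff[OF l] algebra_simps)
    define p :: "nat \<Rightarrow> real^'n" where "p k = (\<chi> i. a $ i - real k / real m * (a $ i - b $ i))" for k
    define r where "r k = l + real k / real m * l" for k
    have step: "\<tau> * free_side E (cube (p (Suc k)) (r (Suc k))) \<le> free_side E (cube (p k) (r k))" for k
      unfolding \<tau>_def
    proof (rule free_side_slight_enlargement[OF porous assms(1)])
      have rS: "r (Suc k) = r k + l / real m" unfolding r_def by (simp add: field_simps add_divide_distrib)
      have lr: "l \<le> r k" unfolding r_def using l by simp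
      then show rpos: "0 < r k" using l by linarith
      show "r k \<le> r (Suc k)" using rS l m0 by simp
      have pS: "p (Suc k) $ i = p k $ i - (a $ i - b $ i) / real m" for i
        unfolding p_def by (simp add: field_simps add_divide_distrib)
      have "(a $ i - b $ i) / real m \<le> l / real m" "0 \<le> (a $ i - b $ i) / real m" for i
        using ab[of i] m0 by (auto intro!: divide_right_mono)
      then show "cube (p k) (r k) \<subseteq> cube (p (Suc k)) (r (Suc k))"
        unfolding cube_subset_cube_iff[OF rpos] pS rS by (simp add: algebra_simps)
      \<comment> \<open>The smaller side falls short of the larger one by the fraction x, which is at most 1/m. By
        Bernoulli's inequality the volume falls short by at most the fraction n/m, and this is at most c/2.\<close>
      define x where "x = l / real m / r (Suc k)"
      have rS0: "0 < r (Suc k)" using rS rpos l m0 by (simp add: add_pos_pos)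
      have "r k / r (Suc k) = 1 - x"
      proof -
        have "x * r (Suc k) = l / real m" using rS0 by (simp add: x_def)
        then have "r k = (1 - x) * r (Suc k)" using rS by (simp add: left_diff_distrib)
        then show ?thesis using rS0 by simp
      qed
      moreover have "x \<le> 1 / real m"
      proof -
        have "l \<le> r (Suc k)" using lr rS l m0 by (smt (verit) divide_nonneg_pos)
        then have "l / r (Suc k) \<le> 1" using rS0 by simp
        then have "l / r (Suc k) / real m \<le> 1 / real m" using m0 by (intro divide_right_mono) auto
        then show ?thesis by (simp add: x_def field_simps)
      qed
      moreover have "real ?n * (1 / real m) \<le> c / 2"
        using m assms(1) m0 by (simp add: field_simps)
      moreover have "1 + real ?n * (- x) \<le> (1 + (- x)) ^ ?n"
      proof (rule Bernoulli_inequality)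
        have "0 \<le> r k / r (Suc k)" using rpos rS0 by simp
        then show "- 1 \<le> - x" using \<open>r k / r (Suc k) = 1 - x\<close> by linarith
      qed
      moreover have "real ?n * x \<le> real ?n * (1 / real m)"
        using \<open>x \<le> 1 / real m\<close> by (intro mult_left_mono) auto
      ultimately have "r k / r (Suc k) = 1 + (- x)" "1 - c / 2 \<le> (1 + (- x)) ^ ?n" by linarith+
      then have "1 - c / 2 \<le> (r k / r (Suc k)) ^ ?n" by metis
      then show "(1 - c / 2) * r (Suc k) ^ ?n \<le> r k ^ ?n"
        using rS0 by (simp add: power_divide pos_le_divide_eq)
    qed
    have "\<tau> ^ k * free_side E (cube (p k) (r k)) \<le> free_side E (cube a l)" for k
    proof (induction k)
      case 0
      have "p 0 = a" "r 0 = l" by (auto simp: p_def r_def vec_eq_iff)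
      then show ?case by simp
    next
      case (Suc k)
      have "\<tau> ^ Suc k * free_side E (cube (p (Suc k)) (r (Suc k)))
          = \<tau> ^ k * (\<tau> * free_side E (cube (p (Suc k)) (r (Suc k))))" by simp
      also have "\<dots> \<le> \<tau> ^ k * free_side E (cube (p k) (r k))"
        using step \<tau> by (intro mult_left_mono) auto
      finally show ?case using Suc by linarith
    qed
    from this[of m] show "\<tau> ^ m * free_side E (cube b (2 * l)) \<le> free_side E (cube a l)"
      using m0 by (simp add: p_def r_def)
  qed
qed

section \<open>Integrals outside the selected free cubes\<close>

text \<open>
  One of the dyadic subcubes of second generation that do not touch the boundary (when the cube has
  side s). It lies at distance s/4 from the complement of the cube, so the distance to E is bounded
  below on it; replacing a free cube by its core loses only the constant factor \<open>4 ^ n\<close> in volume.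
\<close>

definition core_cube :: "real^'n \<Rightarrow> real \<Rightarrow> (real^'n) set" where
  "core_cube b s = cube (\<chi> i. b $ i + s / 4) (s / 4)"

lemma core_cube_dyadic:
  fixes b :: "real^'n"
  assumes "0 < s"
  shows "core_cube b s \<in> dyadic (cube b s)"
proof -
  have "core_cube b s \<in> dyadic_gen 2 (cube b s)"
    unfolding dyadic_gen_cube[OF assms] core_cube_def
    by (rule image_eqI[where x = "\<lambda>_. 1"]) auto
  then show ?thesis by (auto simp: dyadic_def)
qed

lemma infdist_core_cube:
  fixes b :: "real^'n"
  assumes "E \<inter> cube b s = {}" "E \<noteq> {}" "x \<in> core_cube b s"
  shows "s / 4 \<le> infdist x E"
  unfolding infdist_notempty[OF assms(2)]
proof (rule cINF_greatest[OF assms(2)])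
  fix y assume "y \<in> E"
  \<comment> \<open>A point outside the cube violates one of the coordinate bounds, and every point of the core
    keeps the distance s/4 from both of them.\<close>
  then obtain i where i: "y $ i < b $ i \<or> b $ i + s \<le> y $ i"
    using assms(1) by (fastforce simp: cube_def not_le not_less)
  have "b $ i + s / 4 \<le> x $ i" "x $ i < b $ i + s / 4 + s / 4"
    using assms(3) by (auto simp: core_cube_def cube_def)
  then have "s / 4 \<le> \<bar>(x - y) $ i\<bar>" using i by (auto simp: abs_if)
  also have "\<dots> \<le> dist x y" unfolding dist_norm by (rule component_le_norm_cart)
  finally show "s / 4 \<le> dist x y" .
qed

lemma evenly_porous_core_cubes:
  fixes a :: "real^'n"
  assumes "evenly_porous c \<eta> E" "0 < c" "0 < l" "E \<noteq> {}"
  obtains \<Q> where "finite \<Q>" "\<Q> \<subseteq> dyadic (cube a l)"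
    "\<And>Q. Q \<in> \<Q> \<Longrightarrow> \<exists>b s. 0 < s \<and> \<eta> / 4 * free_side E (cube a l) \<le> s \<and> Q = cube b s
      \<and> E \<inter> Q = {} \<and> (\<forall>x\<in>Q. s \<le> infdist x E)"
    "c / 4 ^ CARD('n) * measure lebesgue (cube a l) \<le> measure lebesgue (\<Union>\<Q>)"
proof -
  obtain \<P> where P: "finite \<P>" "\<P> \<subseteq> dyadic (cube a l)" "disjoint \<P>"
      "\<And>Q. Q \<in> \<P> \<Longrightarrow> E \<inter> Q = {} \<and> (\<exists>b s. 0 < s \<and> \<eta> * free_side E (cube a l) \<le> s \<and> Q = cube b s)"
      "c * measure lebesgue (cube a l) \<le> measure lebesgue (\<Union>\<P>)"
    using assms(1,3) unfolding evenly_porous_def by meson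
  have "\<forall>Q\<in>\<P>. \<exists>b s. 0 < s \<and> \<eta> * free_side E (cube a l) \<le> s \<and> Q = cube b s" using P(4) by blast
  then obtain b s where bs: "\<And>Q. Q \<in> \<P> \<Longrightarrow> 0 < s Q"
      "\<And>Q. Q \<in> \<P> \<Longrightarrow> \<eta> * free_side E (cube a l) \<le> s Q" "\<And>Q. Q \<in> \<P> \<Longrightarrow> Q = cube (b Q) (s Q)"
    by metis
  define f where "f Q = core_cube (b Q) (s Q)" for Q
  have f: "f Q \<in> dyadic Q" if "Q \<in> \<P>" for Q
    using core_cube_dyadic[OF bs(1)[OF that], of "b Q"] bs(3)[OF that] unfolding f_def by simp
  have fsub: "f Q \<subseteq> Q" if "Q \<in> \<P>" for Q
    using f[OF that] unfolding dyadic_def by (blast dest: dyadic_gen_subset)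
  have lm: "Q \<in> lmeasurable" if "Q \<in> \<P>" for Q using bs(3)[OF that] cube_lmeasurable by metis
  have disj: "disjnt Q R" if "Q \<in> \<P>" "R \<in> \<P>" "Q \<noteq> R" for Q R
    using P(3) that by (auto simp: disjoint_def disjnt_def)
  have meas: "measure lebesgue (f Q) = measure lebesgue Q / 4 ^ CARD('n)" if "Q \<in> \<P>" for Q
  proof -
    have "measure lebesgue Q = s Q ^ CARD('n)" using bs(3)[OF that] bs(1)[OF that] measure_cube(1) by (metis less_imp_le)
    then show ?thesis using bs(1)[OF that] unfolding f_def core_cube_def
      by (simp add: measure_cube power_divide)
  qed
  have "measure lebesgue (\<Union>(f ` \<P>)) = (\<Sum>Q\<in>\<P>. measure lebesgue (f Q))"
  proof (rule measure_UNION'[OF P(1)])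
    show "f Q \<in> lmeasurable" for Q by (simp add: f_def core_cube_def)
    show "pairwise (\<lambda>i j. disjnt (f i) (f j)) \<P>"
      unfolding pairwise_def using disj fsub by (meson disjnt_subset1 disjnt_subset2)
  qed
  also have "\<dots> = (\<Sum>Q\<in>\<P>. measure lebesgue Q) / 4 ^ CARD('n)"
    by (simp add: meas sum_divide_distrib)
  also have "(\<Sum>Q\<in>\<P>. measure lebesgue Q) = measure lebesgue (\<Union>\<P>)"
    using measure_Union'[of \<P> lebesgue] P(1) lm disj by (simp add: pairwise_def)
  finally have "c / 4 ^ CARD('n) * measure lebesgue (cube a l) \<le> measure lebesgue (\<Union>(f ` \<P>))"
    using P(5) by (simp add: divide_right_mono)
  moreover have "f ` \<P> \<subseteq> dyadic (cube a l)"
    using P(2) f dyadic_trans[OF assms(3)] by blast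
  moreover have "\<exists>d r. 0 < r \<and> \<eta> / 4 * free_side E (cube a l) \<le> r \<and> f Q = cube d r
      \<and> E \<inter> f Q = {} \<and> (\<forall>x\<in>f Q. r \<le> infdist x E)" if Q: "Q \<in> \<P>" for Q
  proof (intro exI conjI ballI)
    show "0 < s Q / 4" using bs(1)[OF Q] by simp
    show "\<eta> / 4 * free_side E (cube a l) \<le> s Q / 4" using bs(2)[OF Q] by simp
    show "f Q = cube (\<chi> i. b Q $ i + s Q / 4) (s Q / 4)" by (simp add: f_def core_cube_def)
    show "E \<inter> f Q = {}" using fsub[OF Q] P(4)[OF Q] by blast
    fix x assume "x \<in> f Q"
    then show "s Q / 4 \<le> infdist x E"
      using infdist_core_cube[of E "b Q" "s Q" x] P(4)[OF Q] bs(3)[OF Q] assms(4) by (simp add: f_def)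
  qed
  ultimately show ?thesis using that[of "f ` \<P>"] P(1) by blast
qed

text \<open>
  An estimate assumed for all cubes with \<open>free_side\<close> at least \<open>\<sigma> * t\<close> carries over to the complement of
  the selected free cubes, without loss in the constant. A cube inside a selected one contributes
  nothing, and a cube disjoint from all of them is covered by the assumption. Any other cube properly
  contains a selected one, so its \<open>free_side\<close> is at least t; hence that of its children is at least
  \<open>\<sigma> * t\<close>, and the children can be treated separately. The number N bounds the number of
  subdivisions, because the selected cubes have side at least t.
\<close>

lemma emeasure_outside_free_cubes_le:
  fixes a :: "real^'n" and \<Q> :: "(real^'n) set set"
  assumes sets: "sets \<nu> = sets lebesgue"
    and \<sigma>: "0 < \<sigma>" "\<And>(a :: real^'n) b l. 0 < l \<Longrightarrow> cube a l \<subseteq> cube b (2 * l) \<Longrightarrow>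
      \<sigma> * free_side E (cube b (2 * l)) \<le> free_side E (cube a l)"
    and t: "0 < t" and \<Q>: "finite \<Q>"
      "\<And>Q. Q \<in> \<Q> \<Longrightarrow> E \<inter> Q = {} \<and> (\<exists>b s. 0 < s \<and> t \<le> s \<and> Q = cube b s)"
    and bound: "\<And>(a :: real^'n) l. 0 < l \<Longrightarrow> l \<le> L \<Longrightarrow> \<sigma> * t \<le> free_side E (cube a l) \<Longrightarrow>
      emeasure \<nu> (cube a l) \<le> B * emeasure lebesgue (cube a l)"
    and "0 < l" "l \<le> L" "l \<le> 2 ^ N * t" "\<sigma> * t \<le> free_side E (cube a l)"
    and "\<And>Q. Q \<in> \<Q> \<Longrightarrow> Q \<in> dyadic (cube a l) \<or> cube a l \<subseteq> Q \<or> cube a l \<inter> Q = {}"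
  shows "emeasure \<nu> (cube a l - \<Union>\<Q>) \<le> B * emeasure lebesgue (cube a l - \<Union>\<Q>)"
proof -
  \<comment> \<open>Either the estimate holds without subdivision, or a selected cube is a proper dyadic subcube.\<close>
  have split: "emeasure \<nu> (cube a l - \<Union>\<Q>) \<le> B * emeasure lebesgue (cube a l - \<Union>\<Q>) \<or>
      t \<le> free_side E (cube a l) \<and> 2 * t \<le> l"
    if P: "0 < l" "l \<le> L" "\<sigma> * t \<le> free_side E (cube a l)"
      "\<And>Q. Q \<in> \<Q> \<Longrightarrow> Q \<in> dyadic (cube a l) \<or> cube a l \<subseteq> Q \<or> cube a l \<inter> Q = {}"
    for a :: "real^'n" and l
  proof -
    consider "\<exists>Q\<in>\<Q>. cube a l \<subseteq> Q" | "\<forall>Q\<in>\<Q>. cube a l \<inter> Q = {}"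
      | Q where "Q \<in> \<Q>" "Q \<in> dyadic (cube a l)" "\<not> cube a l \<subseteq> Q"
      using P(4) by blast
    then show ?thesis
    proof cases
      case 1
      then have e: "cube a l - \<Union>\<Q> = {}" by blast
      show ?thesis unfolding e by simp
    next
      case 2
      then have "cube a l - \<Union>\<Q> = cube a l" by blast
      then show ?thesis using bound[OF P(1-3)] by simp
    next
      case 3
      obtain b s where s: "0 < s" "t \<le> s" "Q = cube b s" "E \<inter> Q = {}"
        using \<Q>(2)[OF 3(1)] by blast
      obtain d j where j: "Q = cube d (l / 2 ^ j)" "Q \<in> dyadic_gen j (cube a l)"
        using dyadicE[OF 3(2) P(1)] by blast
      have "j \<noteq> 0" using j(2) 3(3) P(1) by (intro notI) simp
      then have "(2::real) ^ 1 \<le> 2 ^ j" by (intro power_increasing) auto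
      then have "l / 2 ^ j \<le> l / 2" using P(1) by (intro divide_left_mono) auto
      moreover have "s = l / 2 ^ j"
        using cube_inject(2)[OF s(1), of "l / 2 ^ j" b d] j(1) s(3) P(1) by simp
      ultimately have "s \<le> l / 2" by (simp only:)
      moreover have "s \<le> free_side E (cube a l)"
        using free_side_ge[of s b a l E] dyadic_gen_subset[OF j(2)] s by simp
      ultimately have "t \<le> free_side E (cube a l)" "2 * t \<le> l" using s(2) by linarith+
      then show ?thesis by blast
    qed
  qed
  show ?thesis
    using assms(8-)
  proof (induction N arbitrary: a l)
    case 0
    then show ?case using split[of l a] t by fastforce
  next
    case (Suc N)
    show ?case
    proof (cases "t \<le> free_side E (cube a l) \<and> 2 * t \<le> l")
      case False
      then show ?thesis using split[of l a] Suc.prems by blast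
    next
      case True
      let ?D = "dyadic_gen 1 (cube a l)"
      have cube: "is_cube (cube a l)" using Suc.prems(1) by (auto simp: is_cube_def)
      have fin: "finite ?D"
        using card_dyadic_gen[OF cube, of 1] by (intro card_ge_0_finite) simp
      have un: "\<Union>?D = cube a l" by (rule Union_dyadic_gen[OF cube])
      have disj: "disjnt R R'" if "R \<in> ?D" "R' \<in> ?D" "R \<noteq> R'" for R R'
        using dyadic_gen_disjoint[of 1 "cube a l"] that by (auto simp: pairwise_def)
      have U: "\<Union>\<Q> \<in> sets lebesgue"
        using \<Q> by (intro sets.finite_Union) fastforce+
      have child: "emeasure \<nu> (R - \<Union>\<Q>) \<le> B * emeasure lebesgue (R - \<Union>\<Q>)" and child_sets: "R \<in> sets lebesgue"
        if R: "R \<in> ?D" for R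
      proof -
        obtain b where b: "R = cube b (l / 2)" using R Suc.prems(1) by (auto simp: dyadic_gen_cube)
        then show "R \<in> sets lebesgue" by simp
        have sub: "R \<subseteq> cube a l" by (rule dyadic_gen_subset[OF R])
        show "emeasure \<nu> (R - \<Union>\<Q>) \<le> B * emeasure lebesgue (R - \<Union>\<Q>)"
          unfolding b
        proof (rule Suc.IH)
          show "0 < l / 2" "l / 2 \<le> L" "l / 2 \<le> 2 ^ N * t" using Suc.prems by auto
          have "\<sigma> * t \<le> \<sigma> * free_side E (cube a l)" using True \<sigma>(1) by (intro mult_left_mono) auto
          also have "\<dots> \<le> free_side E (cube b (l / 2))"
            using \<sigma>(2)[of "l / 2" b a] Suc.prems(1) sub b by simp
          finally show "\<sigma> * t \<le> free_side E (cube b (l / 2))" .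
          fix Q assume Q: "Q \<in> \<Q>"
          have "Q \<in> dyadic R \<or> R \<subseteq> Q \<or> R \<inter> Q = {}"
          proof (rule disjE[OF Suc.prems(5)[OF Q]])
            assume "Q \<in> dyadic (cube a l)"
            then obtain j where j: "Q \<in> dyadic_gen j (cube a l)" by (auto simp: dyadic_def)
            show ?thesis
            proof (cases j)
              case 0
              then show ?thesis using j Suc.prems(1) sub by simp
            next
              case (Suc i)
              then obtain R' where R': "R' \<in> ?D" "Q \<in> dyadic_gen i R'"
                using dyadic_gen_descend[OF Suc.prems(1)] j by metis
              show ?thesis
              proof (cases "R = R'")
                case True
                then show ?thesis using R'(2) by (auto simp: dyadic_def)
              next
                case False
                then have "disjnt R R'" using disj R R'(1) by blast
                then show ?thesis using dyadic_gen_subset[OF R'(2)] by (auto simp: disjnt_def)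
              qed
            qed
          qed (use sub in blast)
          then show "Q \<in> dyadic (cube b (l / 2)) \<or> cube b (l / 2) \<subseteq> Q \<or> cube b (l / 2) \<inter> Q = {}"
            unfolding b .
        qed
      qed
      have dfam: "disjoint_family_on (\<lambda>R. R - \<Union>\<Q>) ?D"
        unfolding disjoint_family_on_def using disj by (auto simp: disjnt_def)
      have un': "cube a l - \<Union>\<Q> = (\<Union>R\<in>?D. R - \<Union>\<Q>)" using un by blast
      have meas: "(\<lambda>R. R - \<Union>\<Q>) ` ?D \<subseteq> sets lebesgue"
        using child_sets U by (auto intro: sets.Diff)
      have "emeasure \<nu> (cube a l - \<Union>\<Q>) = (\<Sum>R\<in>?D. emeasure \<nu> (R - \<Union>\<Q>))"
        unfolding un' using meas by (intro sum_emeasure[symmetric] dfam fin) (simp add: sets)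
      also have "\<dots> \<le> (\<Sum>R\<in>?D. B * emeasure lebesgue (R - \<Union>\<Q>))"
        by (intro sum_mono child)
      also have "\<dots> = B * (\<Sum>R\<in>?D. emeasure lebesgue (R - \<Union>\<Q>))"
        by (simp add: sum_distrib_left)
      also have "\<dots> = B * emeasure lebesgue (cube a l - \<Union>\<Q>)"
        unfolding un' using meas by (subst sum_emeasure[OF _ dfam fin]) auto
      finally show ?thesis .
    qed
  qed
qed

section \<open>The integral of the weight over a cube\<close>

text \<open>
  The distance is cut off from below, so that the weight is bounded and the estimate to be improved
  holds with some finite constant at the start.
\<close>

definition truncated_weight :: "(real^'n) set \<Rightarrow> real \<Rightarrow> real \<Rightarrow> real^'n \<Rightarrow> ennreal" where
  "truncated_weight E \<alpha> \<epsilon> x = ennreal (max \<epsilon> (infdist x E) powr (- \<alpha>))"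

lemma truncated_weight_measurable [measurable]:
  "truncated_weight (E :: (real^'n) set) \<alpha> \<epsilon> \<in> borel_measurable lebesgue"
proof -
  have "(\<lambda>x. infdist x E) \<in> borel_measurable lborel"
    by (simp add: borel_measurable_continuous_onI continuous_on_infdist)
  then have "truncated_weight E \<alpha> \<epsilon> \<in> borel_measurable lborel"
    unfolding truncated_weight_def[abs_def] by measurable
  then show ?thesis by (rule measurable_completion)
qed

lemma porosity_ratio_bounds:
  fixes c :: real
  assumes "0 < c" "c < 1"
  shows "0 < 1 - c / 4 ^ n" "1 - c / 4 ^ n < 1"
proof -
  have "1 \<le> (4::real) ^ n" by (rule one_le_power) simp
  then have "c < 4 ^ n" using assms(2) by linarith
  then show "0 < 1 - c / 4 ^ n" "1 - c / 4 ^ n < 1" using assms(1) by simp_all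
qed

text \<open>
  The summand \<open>(\<eta> / 4) powr - \<alpha>\<close> comes from the cores of the free cubes, where the distance to E is at
  least \<open>\<eta> / 4 * g(P)\<close>. The factor of K comes from the rest of P: it has relative measure at most
  \<open>1 - c / 4 ^ n\<close>, and the assumed estimate is applied there to cubes whose \<open>free_side\<close> is at least
  \<open>\<sigma> * \<eta> / 4 * g(P)\<close>.
\<close>

lemma truncated_integral_improve:
  fixes E :: "(real^'n) set"
  assumes porous: "evenly_porous c \<eta> E" "0 < c" "c < 1" "0 < \<eta>" "\<eta> < 1" "E \<noteq> {}"
    and \<sigma>: "0 < \<sigma>" "\<sigma> \<le> 1" "\<And>(a :: real^'n) b l. 0 < l \<Longrightarrow> cube a l \<subseteq> cube b (2 * l) \<Longrightarrow>
      \<sigma> * free_side E (cube b (2 * l)) \<le> free_side E (cube a l)"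
    and "0 < \<alpha>" "0 < \<epsilon>" "0 \<le> K"
    and bound: "\<And>(a :: real^'n) l. 0 < l \<Longrightarrow> l \<le> L \<Longrightarrow>
      emeasure (density lebesgue (truncated_weight E \<alpha> \<epsilon>)) (cube a l)
        \<le> ennreal (K * free_side E (cube a l) powr (- \<alpha>)) * emeasure lebesgue (cube a l)"
    and l: "0 < l" "l \<le> L"
  shows "emeasure (density lebesgue (truncated_weight E \<alpha> \<epsilon>)) (cube a l)
    \<le> ennreal (((\<eta> / 4) powr (- \<alpha>) + (\<sigma> * \<eta> / 4) powr (- \<alpha>) * (1 - c / 4 ^ CARD('n)) * K)
        * free_side E (cube a l) powr (- \<alpha>)) * emeasure lebesgue (cube a l)"
proof -
  let ?\<nu> = "density lebesgue (truncated_weight E \<alpha> \<epsilon>)"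
  let ?P = "cube a l"
  let ?g = "free_side E ?P"
  let ?q = "1 - c / 4 ^ CARD('n)"
  define t where "t = \<eta> / 4 * ?g"
  have g: "0 < ?g" by (rule free_side_pos[OF porous(1,2) l(1)])
  have t: "0 < t" using g porous(4) by (simp add: t_def)
  obtain \<Q> where Q: "finite \<Q>" "\<Q> \<subseteq> dyadic ?P"
    "\<And>Q. Q \<in> \<Q> \<Longrightarrow> \<exists>b s. 0 < s \<and> t \<le> s \<and> Q = cube b s \<and> E \<inter> Q = {} \<and> (\<forall>x\<in>Q. s \<le> infdist x E)"
    "c / 4 ^ CARD('n) * measure lebesgue ?P \<le> measure lebesgue (\<Union>\<Q>)"
    using evenly_porous_core_cubes[OF porous(1,2) l(1) porous(6), of a] unfolding t_def by metis
  have sub: "\<Union>\<Q> \<subseteq> ?P" using Q(2) unfolding dyadic_def by (blast dest: dyadic_gen_subset)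
  have lm: "Q \<in> lmeasurable" if "Q \<in> \<Q>" for Q using Q(3)[OF that] by auto
  have Ulm: "\<Union>\<Q> \<in> lmeasurable" using lm Q(1) by (intro fmeasurable.finite_Union) auto
  have q0: "0 \<le> ?q"
    using porosity_ratio_bounds(1)[OF porous(2,3)] by (rule less_imp_le)
  define B where "B = K * (\<sigma> * t) powr (- \<alpha>)"
  have B: "0 \<le> B" using assms by (simp add: B_def)
  have B': "emeasure ?\<nu> (cube b m) \<le> ennreal B * emeasure lebesgue (cube b m)"
    if m: "0 < m" "m \<le> L" "\<sigma> * t \<le> free_side E (cube b m)" for b :: "real^'n" and m
  proof -
    have "free_side E (cube b m) powr (- \<alpha>) \<le> (\<sigma> * t) powr (- \<alpha>)"
      using m(3) \<sigma>(1) t assms(10) by (intro powr_mono2') auto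
    then have "K * free_side E (cube b m) powr (- \<alpha>) \<le> B"
      unfolding B_def using assms(12) by (rule mult_left_mono)
    then show ?thesis
      using bound[OF m(1,2), of b] by (meson ennreal_leI mult_right_mono order_trans zero_le)
  qed
  have inside: "emeasure ?\<nu> (\<Union>\<Q>) \<le> ennreal (t powr (- \<alpha>)) * emeasure lebesgue (\<Union>\<Q>)"
  proof -
    have "emeasure ?\<nu> (\<Union>\<Q>) = (\<integral>\<^sup>+x. truncated_weight E \<alpha> \<epsilon> x * indicator (\<Union>\<Q>) x \<partial>lebesgue)"
      using Ulm by (intro emeasure_density) (auto simp: fmeasurableD)
    also have "\<dots> \<le> (\<integral>\<^sup>+x. ennreal (t powr (- \<alpha>)) * indicator (\<Union>\<Q>) x \<partial>lebesgue)"
    proof (rule nn_integral_mono)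
      fix x :: "real^'n"
      show "truncated_weight E \<alpha> \<epsilon> x * indicator (\<Union>\<Q>) x \<le> ennreal (t powr (- \<alpha>)) * indicator (\<Union>\<Q>) x"
      proof (cases "x \<in> \<Union>\<Q>")
        case True
        then obtain s where "t \<le> s" "s \<le> infdist x E" using Q(3) by blast
        then have "max \<epsilon> (infdist x E) powr (- \<alpha>) \<le> t powr (- \<alpha>)"
          using t assms(10) by (intro powr_mono2') auto
        then show ?thesis using True by (simp add: truncated_weight_def ennreal_leI)
      qed simp
    qed
    also have "\<dots> = ennreal (t powr (- \<alpha>)) * emeasure lebesgue (\<Union>\<Q>)"
      using Ulm by (intro nn_integral_cmult_indicator) (auto simp: fmeasurableD)
    finally show ?thesis .
  qed
  obtain N :: nat where N: "l / t < 2 ^ N" using real_arch_pow[of 2 "l / t"] by auto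
  have outside: "emeasure ?\<nu> (?P - \<Union>\<Q>) \<le> ennreal B * emeasure lebesgue (?P - \<Union>\<Q>)"
  proof (rule emeasure_outside_free_cubes_le[where \<sigma> = \<sigma> and t = t and L = L and N = N and E = E])
    show "l \<le> 2 ^ N * t" using N t by (simp add: pos_divide_less_eq)
    have "\<sigma> * (\<eta> / 4) \<le> 1 * 1" using \<sigma>(1,2) porous(4,5) by (intro mult_mono) auto
    then have "\<sigma> * (\<eta> / 4) * ?g \<le> 1 * 1 * ?g" using g by (intro mult_right_mono) auto
    then show "\<sigma> * t \<le> ?g" by (simp add: t_def)
    show "Q \<in> dyadic ?P \<or> ?P \<subseteq> Q \<or> ?P \<inter> Q = {}" if "Q \<in> \<Q>" for Q using that Q(2) by blast
    show "E \<inter> Q = {} \<and> (\<exists>b s. 0 < s \<and> t \<le> s \<and> Q = cube b s)" if "Q \<in> \<Q>" for Q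
      using Q(3)[OF that] by blast
  qed (use B' t l \<sigma> Q(1) in auto)
  have Usets: "\<Union>\<Q> \<in> sets lebesgue" using Ulm by (rule fmeasurableD)
  have "emeasure ?\<nu> ?P = emeasure ?\<nu> (\<Union>\<Q>) + emeasure ?\<nu> (?P - \<Union>\<Q>)"
    using sub Usets by (subst plus_emeasure) (auto intro!: arg_cong[where f = "emeasure ?\<nu>"])
  also have "\<dots> \<le> ennreal (t powr (- \<alpha>)) * emeasure lebesgue ?P
      + ennreal B * emeasure lebesgue (?P - \<Union>\<Q>)"
  proof (intro add_mono outside order_trans[OF inside] mult_left_mono)
    show "emeasure lebesgue (\<Union>\<Q>) \<le> emeasure lebesgue ?P" using sub by (intro emeasure_mono) auto
  qed auto
  also have "\<dots> \<le> ennreal (t powr (- \<alpha>)) * emeasure lebesgue ?P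
      + ennreal B * (ennreal ?q * emeasure lebesgue ?P)"
  proof (intro add_left_mono mult_left_mono)
    have "measure lebesgue (?P - \<Union>\<Q>) = measure lebesgue ?P - measure lebesgue (\<Union>\<Q>)"
      using sub Ulm Usets by (subst measurable_measure_Diff) auto
    also have "\<dots> \<le> ?q * measure lebesgue ?P" using Q(4) by (simp add: algebra_simps)
    finally have "ennreal (measure lebesgue (?P - \<Union>\<Q>)) \<le> ennreal (?q * measure lebesgue ?P)"
      by (rule ennreal_leI)
    moreover have "?P - \<Union>\<Q> \<in> lmeasurable" using Usets by (intro fmeasurable_Diff) auto
    ultimately show "emeasure lebesgue (?P - \<Union>\<Q>) \<le> ennreal ?q * emeasure lebesgue ?P"
      using q0 by (simp only: emeasure_eq_measure2 cube_lmeasurable ennreal_mult')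
  qed simp
  also have "ennreal (t powr (- \<alpha>)) * emeasure lebesgue ?P + ennreal B * (ennreal ?q * emeasure lebesgue ?P)
      = ennreal (t powr (- \<alpha>) + B * ?q) * emeasure lebesgue ?P"
    using B q0 by (simp add: ennreal_plus ennreal_mult distrib_right mult.assoc)
  also have "t powr (- \<alpha>) + B * ?q = ((\<eta> / 4) powr (- \<alpha>) + (\<sigma> * \<eta> / 4) powr (- \<alpha>) * ?q * K) * ?g powr (- \<alpha>)"
  proof -
    have "t powr (- \<alpha>) = (\<eta> / 4) powr (- \<alpha>) * ?g powr (- \<alpha>)"
      unfolding t_def using porous(4) g by (subst powr_mult) auto
    moreover have "(\<sigma> * t) powr (- \<alpha>) = (\<sigma> * \<eta> / 4 * ?g) powr (- \<alpha>)"
      by (simp add: t_def mult.assoc)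
    moreover have "(\<sigma> * \<eta> / 4 * ?g) powr (- \<alpha>) = (\<sigma> * \<eta> / 4) powr (- \<alpha>) * ?g powr (- \<alpha>)"
      using porous(4) g \<sigma>(1) by (subst powr_mult) auto
    ultimately show ?thesis by (simp add: B_def algebra_simps)
  qed
  finally show ?thesis by (simp add: mult_left_mono)
qed

text \<open>
  The constant \<open>A / (1 - \<theta>)\<close> is the fixed point of \<open>K \<mapsto> A + \<theta> * K\<close>. The improvement step is repeated
  for all cubes of side at most l at once, because it needs the estimate on the cubes of the decomposition.
\<close>

lemma truncated_integral_le:
  fixes E :: "(real^'n) set" and a :: "real^'n"
  assumes porous: "evenly_porous c \<eta> E" "0 < c" "c < 1" "0 < \<eta>" "\<eta> < 1" "E \<noteq> {}"
    and \<sigma>: "0 < \<sigma>" "\<sigma> \<le> 1" "\<And>(a :: real^'n) b l. 0 < l \<Longrightarrow> cube a l \<subseteq> cube b (2 * l) \<Longrightarrow>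
      \<sigma> * free_side E (cube b (2 * l)) \<le> free_side E (cube a l)"
    and \<theta>: "\<theta> = (\<sigma> * \<eta> / 4) powr (- \<alpha>) * (1 - c / 4 ^ CARD('n))" "\<theta> < 1"
    and "0 < \<alpha>" "0 < \<epsilon>" "0 < l"
  shows "emeasure (density lebesgue (truncated_weight E \<alpha> \<epsilon>)) (cube a l)
    \<le> ennreal ((\<eta> / 4) powr (- \<alpha>) / (1 - \<theta>) * free_side E (cube a l) powr (- \<alpha>)) * emeasure lebesgue (cube a l)"
proof -
  let ?\<nu> = "density lebesgue (truncated_weight E \<alpha> \<epsilon>)"
  define A where "A = (\<eta> / 4) powr (- \<alpha>)"
  \<comment> \<open>Starting constant: the truncated weight is at most \<open>\<epsilon> powr - \<alpha>\<close>, and \<open>free_side\<close> is at most l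
    on the cubes considered.\<close>
  define K0 where "K0 = \<epsilon> powr (- \<alpha>) * l powr \<alpha>"
  have q0: "0 \<le> 1 - c / 4 ^ CARD('n)"
    using porosity_ratio_bounds(1)[OF porous(2,3)] by (rule less_imp_le)
  have \<theta>0: "0 \<le> \<theta>" unfolding \<theta>(1) using q0 by (intro mult_nonneg_nonneg) auto
  have A0: "0 \<le> A / (1 - \<theta>)" using \<theta>(2) by (simp add: A_def)
  have step: "emeasure ?\<nu> (cube b m)
      \<le> ennreal ((A / (1 - \<theta>) + \<theta> ^ k * K0) * free_side E (cube b m) powr (- \<alpha>)) * emeasure lebesgue (cube b m)"
    if "0 < m" "m \<le> l" for b :: "real^'n" and m k
    using that
  proof (induction k arbitrary: b m)
    case 0
    have g: "0 < free_side E (cube b m)" "free_side E (cube b m) \<le> l"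
      using free_side_pos[OF porous(1,2) 0(1)] free_side_le_side[OF porous(1,2) 0(1)] 0(2)
      by (auto intro: order_trans)
    have "emeasure ?\<nu> (cube b m) = (\<integral>\<^sup>+x. truncated_weight E \<alpha> \<epsilon> x * indicator (cube b m) x \<partial>lebesgue)"
      by (intro emeasure_density) auto
    also have "\<dots> \<le> (\<integral>\<^sup>+x. ennreal (\<epsilon> powr (- \<alpha>)) * indicator (cube b m) x \<partial>lebesgue)"
      unfolding truncated_weight_def
      by (intro nn_integral_mono mult_right_mono ennreal_leI powr_mono2') (use assms in auto)
    also have "\<dots> = ennreal (\<epsilon> powr (- \<alpha>)) * emeasure lebesgue (cube b m)"
      by (intro nn_integral_cmult_indicator) auto
    also have "\<dots> \<le> ennreal ((A / (1 - \<theta>) + \<theta> ^ 0 * K0) * free_side E (cube b m) powr (- \<alpha>)) * emeasure lebesgue (cube b m)"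
    proof (intro mult_right_mono ennreal_leI)
      have "l powr (- \<alpha>) \<le> free_side E (cube b m) powr (- \<alpha>)"
        using g assms by (intro powr_mono2') auto
      then have "K0 * l powr (- \<alpha>) \<le> (A / (1 - \<theta>) + \<theta> ^ 0 * K0) * free_side E (cube b m) powr (- \<alpha>)"
        using A0 by (intro mult_mono) (auto simp: K0_def)
      moreover have "K0 * l powr (- \<alpha>) = \<epsilon> powr (- \<alpha>)"
        unfolding K0_def using assms by (simp add: mult.assoc powr_add[symmetric])
      ultimately show "\<epsilon> powr (- \<alpha>) \<le> (A / (1 - \<theta>) + \<theta> ^ 0 * K0) * free_side E (cube b m) powr (- \<alpha>)" by simp
    qed auto
    finally show ?case .
  next
    case (Suc k)
    have nn: "0 \<le> A / (1 - \<theta>) + \<theta> ^ k * K0" using A0 \<theta>0 by (simp add: K0_def)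
    \<comment> \<open>The deviation from the fixed point is multiplied by \<open>\<theta>\<close> in each step.\<close>
    have "A + \<theta> * (A / (1 - \<theta>) + \<theta> ^ k * K0) = A / (1 - \<theta>) + \<theta> ^ Suc k * K0"
      using \<theta>(2) by (simp add: field_simps)
    then show ?case
      using truncated_integral_improve[OF porous \<sigma> assms(12,13) nn Suc.IH Suc.prems, of b]
      unfolding A_def[symmetric] \<theta>(1)[symmetric] by simp
  qed
  let ?g = "free_side E (cube a l) powr (- \<alpha>)"
  have "(\<lambda>k. (A / (1 - \<theta>) + \<theta> ^ k * K0) * ?g * l ^ CARD('n)) \<longlonglongrightarrow> (A / (1 - \<theta>) + 0 * K0) * ?g * l ^ CARD('n)"
    using \<theta>0 \<theta>(2) by (intro tendsto_intros) auto
  then have lim: "(\<lambda>k. ennreal ((A / (1 - \<theta>) + \<theta> ^ k * K0) * ?g * l ^ CARD('n)))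
      \<longlonglongrightarrow> ennreal (A / (1 - \<theta>) * ?g * l ^ CARD('n))"
    by (intro tendsto_ennrealI) simp
  have "emeasure ?\<nu> (cube a l) \<le> ennreal ((A / (1 - \<theta>) + \<theta> ^ k * K0) * ?g * l ^ CARD('n))" for k
    using step[of l a k] assms(14) A0 \<theta>0 by (simp add: emeasure_cube ennreal_mult' K0_def del: emeasure_completion)
  then have "emeasure ?\<nu> (cube a l) \<le> ennreal (A / (1 - \<theta>) * ?g * l ^ CARD('n))"
    by (intro LIMSEQ_le_const[OF lim]) auto
  also have "\<dots> = ennreal (A / (1 - \<theta>) * ?g) * ennreal (l ^ CARD('n))"
    using assms(14) A0 by (intro ennreal_mult mult_nonneg_nonneg) auto
  also have "ennreal (l ^ CARD('n)) = emeasure lebesgue (cube a l)"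
    using assms(14) by (simp only: emeasure_cube less_imp_le)
  finally show ?thesis unfolding A_def .
qed

lemma dist_weight_le_SUP:
  assumes "0 < \<alpha>"
  shows "dist_weight E \<alpha> x \<le> (SUP j. truncated_weight E \<alpha> (1 / real (Suc j)) x)"
proof (cases "infdist x E = 0")
  case True
  have "\<exists>j\<in>UNIV. of_nat n \<le> truncated_weight E \<alpha> (1 / real (Suc j)) x" for n
  proof -
    obtain j :: nat where j: "real j \<ge> real n powr (1 / \<alpha>)" using real_arch_simple by blast
    have "real n = (real n powr (1 / \<alpha>)) powr \<alpha>" using assms by (simp add: powr_powr)
    also have "\<dots> \<le> real (Suc j) powr \<alpha>" using j assms by (intro powr_mono2) auto
    also have "\<dots> = (1 / real (Suc j)) powr (- \<alpha>)" by (simp add: powr_minus powr_divide)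
    also have "\<dots> = max (1 / real (Suc j)) (infdist x E) powr (- \<alpha>)" unfolding True by simp
    finally have "ennreal (real n) \<le> truncated_weight E \<alpha> (1 / real (Suc j)) x"
      unfolding truncated_weight_def by (rule ennreal_leI)
    then show ?thesis by (auto simp: ennreal_of_nat_eq_real_of_nat)
  qed
  then have "(SUP j. truncated_weight E \<alpha> (1 / real (Suc j)) x) = \<infinity>"
    unfolding infinity_ennreal_def by (rule ennreal_SUP_eq_top)
  then show ?thesis by (simp only: infinity_ennreal_def top_greatest)
next
  case False
  then have d: "0 < infdist x E" using infdist_nonneg[of x E] by linarith
  then obtain j where "1 / real (Suc j) < infdist x E" using nat_approx_posE by blast
  then have "dist_weight E \<alpha> x = truncated_weight E \<alpha> (1 / real (Suc j)) x"
    using False by (simp add: dist_weight_def truncated_weight_def max_def)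
  then show ?thesis by (simp only:) (rule SUP_upper, simp)
qed

lemma truncated_weight_mono:
  assumes "0 < \<alpha>" "0 < \<epsilon>" "\<epsilon> \<le> \<delta>"
  shows "truncated_weight E \<alpha> \<delta> x \<le> truncated_weight E \<alpha> \<epsilon> x"
  unfolding truncated_weight_def by (intro ennreal_leI powr_mono2') (use assms in auto)

lemma dist_weight_integral_le:
  fixes E :: "(real^'n) set" and a :: "real^'n"
  assumes "0 < \<alpha>"
    and bound: "\<And>\<epsilon>. 0 < \<epsilon> \<Longrightarrow> emeasure (density lebesgue (truncated_weight E \<alpha> \<epsilon>)) (cube a l) \<le> M"
  shows "(\<integral>\<^sup>+x\<in>cube a l. dist_weight E \<alpha> x \<partial>lebesgue) \<le> M"
proof -
  let ?f = "\<lambda>j x. truncated_weight E \<alpha> (1 / real (Suc j)) x * indicator (cube a l) x"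
  have "(\<integral>\<^sup>+x\<in>cube a l. dist_weight E \<alpha> x \<partial>lebesgue) \<le> (\<integral>\<^sup>+x. (SUP j. ?f j x) \<partial>lebesgue)"
    unfolding SUP_mult_right_ennreal[symmetric]
    by (intro nn_integral_mono mult_right_mono dist_weight_le_SUP[OF assms(1)]) simp
  also have "\<dots> = (SUP j. \<integral>\<^sup>+x. ?f j x \<partial>lebesgue)"
  proof (rule nn_integral_monotone_convergence_SUP)
    show "incseq ?f"
    proof (intro incseq_SucI le_funI mult_right_mono truncated_weight_mono[OF assms(1)])
      fix j show "1 / real (Suc (Suc j)) \<le> 1 / real (Suc j)" by (intro divide_left_mono) auto
    qed auto
    show "?f j \<in> borel_measurable lebesgue" for j
      by (intro borel_measurable_times_ennreal truncated_weight_measurable borel_measurable_indicator) simp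
  qed
  also have "\<dots> \<le> M"
  proof (rule SUP_least)
    fix j
    have "(\<integral>\<^sup>+x. ?f j x \<partial>lebesgue) = emeasure (density lebesgue (truncated_weight E \<alpha> (1 / real (Suc j)))) (cube a l)"
      by (rule emeasure_density[symmetric]) auto
    also have "\<dots> \<le> M" by (rule bound) simp
    finally show "(\<integral>\<^sup>+x. ?f j x \<partial>lebesgue) \<le> M" .
  qed
  finally show ?thesis .
qed

section \<open>Membership in the Muckenhoupt class\<close>

lemma dist_cube_le:
  fixes x y :: "real^'n"
  assumes "x \<in> cube a l" "y \<in> cube a l"
  shows "dist x y \<le> real CARD('n) * l"
proof -
  have "dist x y \<le> (\<Sum>i\<in>UNIV. \<bar>(x - y) $ i\<bar>)" unfolding dist_norm by (rule norm_le_l1_cart)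
  also have "\<dots> \<le> (\<Sum>i\<in>(UNIV :: 'n set). l)"
  proof (rule sum_mono)
    fix i
    have "a $ i \<le> x $ i \<and> x $ i < a $ i + l" "a $ i \<le> y $ i \<and> y $ i < a $ i + l"
      using assms by (auto simp: cube_def)
    then show "\<bar>(x - y) $ i\<bar> \<le> l" by (simp add: abs_le_iff)
  qed
  finally show ?thesis by simp
qed

text \<open>
  Around x the open ball of radius r, the distance to E, is free. It contains the cubes of side at most
  r/(2n) having x in their closure, and since r/(2n) is at most l, one of them fits into the given cube.
\<close>

lemma infdist_le_free_side:
  fixes a x :: "real^'n"
  assumes porous: "evenly_porous c \<eta> E" "0 < c" "0 < l"
    and x: "x \<in> cube a l" "infdist x E \<le> 2 * real CARD('n) * l"
  shows "infdist x E \<le> 2 * real CARD('n) * free_side E (cube a l)"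
proof (cases "infdist x E = 0")
  case True
  then show ?thesis using free_side_pos[OF porous, of a] by simp
next
  case False
  let ?n = "real CARD('n)"
  define s where "s = infdist x E / (2 * ?n)"
  have r: "0 < infdist x E" using False infdist_nonneg[of x E] by linarith
  have s: "0 < s" "s \<le> l" using r x(2) by (auto simp: s_def pos_divide_le_eq mult.commute)
  define b where "b = (\<chi> i. min (x $ i) (a $ i + l - s))"
  have xa: "a $ i \<le> x $ i" "x $ i < a $ i + l" for i using x(1) by (auto simp: cube_def)
  have sub: "cube b s \<subseteq> cube a l"
    unfolding cube_subset_cube_iff[OF s(1)] using xa s by (auto simp: b_def)
  have "E \<inter> cube b s = {}"
  proof (rule ccontr)
    assume "E \<inter> cube b s \<noteq> {}"
    then obtain y where y: "y \<in> E" "y \<in> cube b s" by blast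
    have "dist x y \<le> (\<Sum>i\<in>UNIV. \<bar>(x - y) $ i\<bar>)" unfolding dist_norm by (rule norm_le_l1_cart)
    also have "\<dots> \<le> (\<Sum>i\<in>(UNIV :: 'n set). s)"
    proof (rule sum_mono)
      fix i
      have "b $ i \<le> y $ i \<and> y $ i < b $ i + s" using y(2) by (auto simp: cube_def)
      moreover have "x $ i - s \<le> b $ i" "b $ i \<le> x $ i" using xa(2)[of i] s(1) by (auto simp: b_def min_def)
      ultimately show "\<bar>(x - y) $ i\<bar> \<le> s" by (simp add: abs_le_iff)
    qed
    also have "\<dots> = infdist x E / 2" by (simp add: s_def)
    finally show False using infdist_le[OF y(1), of x] r by linarith
  qed
  then have "s \<le> free_side E (cube a l)" using free_side_ge[OF s(1) sub] by blast
  then have "s * (2 * ?n) \<le> free_side E (cube a l) * (2 * ?n)" by (intro mult_right_mono) auto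
  then show ?thesis by (simp add: s_def mult.commute)
qed

lemma dist_weight_le:
  assumes "0 < \<alpha>" "0 < r" "r \<le> infdist x E"
  shows "dist_weight E \<alpha> x \<le> ennreal (r powr (- \<alpha>))"
proof -
  have "infdist x E powr (- \<alpha>) \<le> r powr (- \<alpha>)"
    using assms by (intro powr_mono2') auto
  then show ?thesis using assms by (simp add: dist_weight_def ennreal_leI)
qed

lemma dist_weight_ge:
  assumes "0 < \<alpha>" "infdist x E \<le> r"
  shows "ennreal (r powr (- \<alpha>)) \<le> dist_weight E \<alpha> x"
proof (cases "infdist x E = 0")
  case False
  then have "0 < infdist x E" using infdist_nonneg[of x E] by linarith
  then have "r powr (- \<alpha>) \<le> infdist x E powr (- \<alpha>)"
    using assms by (intro powr_mono2') auto
  then show ?thesis using False by (simp add: dist_weight_def ennreal_leI)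
qed (simp add: dist_weight_def)

text \<open>
  If P has a point at distance more than 2nl from E, the distance varies on P by a factor at most 3, and
  so does the weight, because \<open>\<alpha> \<le> 1\<close>. Otherwise the distance is at most 2n g(P) throughout P, and the
  lower bound for the weight that follows matches the assumed bound of its average.
\<close>

lemma A1_bound_dist_weight:
  fixes E :: "(real^'n) set"
  assumes porous: "evenly_porous c \<eta> E" "0 < c" and \<alpha>: "0 < \<alpha>" "\<alpha> \<le> 1" and "0 \<le> C"
    and bound: "\<And>(a :: real^'n) l. 0 < l \<Longrightarrow> (\<integral>\<^sup>+x\<in>cube a l. dist_weight E \<alpha> x \<partial>lebesgue)
      \<le> ennreal (C * free_side E (cube a l) powr (- \<alpha>)) * emeasure lebesgue (cube a l)"
  shows "A1_bound (dist_weight E \<alpha>) (max 3 (2 * real CARD('n) * C))"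
proof -
  let ?n = "real CARD('n)" and ?C = "max 3 (2 * real CARD('n) * C)"
  have n1: "1 \<le> ?n" by (simp add: Suc_leI)
  have "(\<integral>\<^sup>+x\<in>cube a l. dist_weight E \<alpha> x \<partial>lebesgue) / emeasure lebesgue (cube a l)
      \<le> ennreal ?C * ess_inf_on (cube a l) (dist_weight E \<alpha>)"
    if l: "0 < l" for a :: "real^'n" and l
  proof -
    let ?P = "cube a l"
    have "\<exists>z\<ge>0. (\<forall>x\<in>?P. ennreal z \<le> dist_weight E \<alpha> x) \<and>
        (\<integral>\<^sup>+x\<in>?P. dist_weight E \<alpha> x \<partial>lebesgue) \<le> ennreal (?C * z) * emeasure lebesgue ?P"
    proof (cases "\<exists>x0\<in>?P. 2 * ?n * l < infdist x0 E")
      case True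
      then obtain x0 where x0: "x0 \<in> ?P" "2 * ?n * l < infdist x0 E" by blast
      \<comment> \<open>The diameter of P is at most nl, hence at most r/2.\<close>
      define r where "r = infdist x0 E"
      have r: "0 < r" using x0(2) l n1 unfolding r_def by (smt (verit) mult_nonneg_nonneg)
      have near: "r / 2 \<le> infdist x E \<and> infdist x E \<le> 3 * r / 2" if "x \<in> ?P" for x
      proof -
        have d: "dist x x0 \<le> r / 2" using dist_cube_le[OF that x0(1)] x0(2) unfolding r_def by linarith
        have "infdist x E \<le> r + dist x x0" "r \<le> infdist x E + dist x x0"
          using infdist_triangle[of x E x0] infdist_triangle[of x0 E x] by (auto simp: r_def dist_commute)
        then show ?thesis using d by linarith
      qed
      define z where "z = (3 * r / 2) powr (- \<alpha>)"
      have lower: "ennreal z \<le> dist_weight E \<alpha> x" if "x \<in> ?P" for x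
        unfolding z_def using near[OF that] by (intro dist_weight_ge \<alpha>(1)) auto
      have "(r / 2) powr (- \<alpha>) = 3 powr \<alpha> * z"
      proof -
        have "z = (3 * (r / 2)) powr (- \<alpha>)" by (simp add: z_def)
        also have "\<dots> = 3 powr (- \<alpha>) * (r / 2) powr (- \<alpha>)" using r by (subst powr_mult) auto
        finally show ?thesis by (simp add: powr_add[symmetric] mult.assoc[symmetric])
      qed
      also have "\<dots> \<le> ?C * z"
      proof (rule mult_right_mono)
        have "(3::real) powr \<alpha> \<le> 3 powr 1" using \<alpha>(2) by (intro powr_mono) auto
        then show "3 powr \<alpha> \<le> ?C" by simp
      qed (simp add: z_def)
      finally have up: "(r / 2) powr (- \<alpha>) \<le> ?C * z" .
      have "(\<integral>\<^sup>+x\<in>?P. dist_weight E \<alpha> x \<partial>lebesgue) \<le> (\<integral>\<^sup>+x. ennreal (?C * z) * indicator ?P x \<partial>lebesgue)"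
      proof (rule nn_integral_mono)
        fix x :: "real^'n"
        show "dist_weight E \<alpha> x * indicator ?P x \<le> ennreal (?C * z) * indicator ?P x"
        proof (cases "x \<in> ?P")
          case True
          have "dist_weight E \<alpha> x \<le> ennreal ((r / 2) powr (- \<alpha>))"
            using near[OF True] r by (intro dist_weight_le \<alpha>(1)) auto
          also have "\<dots> \<le> ennreal (?C * z)" using up by (rule ennreal_leI)
          finally show ?thesis using True by simp
        qed simp
      qed
      also have "\<dots> = ennreal (?C * z) * emeasure lebesgue ?P"
        by (intro nn_integral_cmult_indicator) auto
      finally show ?thesis using lower by (intro exI[of _ z]) (auto simp: z_def)
    next
      case False
      define g where "g = free_side E ?P"
      have g: "0 < g" unfolding g_def by (rule free_side_pos[OF porous l])
      define z where "z = (2 * ?n * g) powr (- \<alpha>)"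
      have lower: "ennreal z \<le> dist_weight E \<alpha> x" if "x \<in> ?P" for x
        unfolding z_def g_def using infdist_le_free_side[OF porous l that] False that
        by (intro dist_weight_ge \<alpha>(1)) (auto simp: not_less)
      have "C * g powr (- \<alpha>) = C * (2 * ?n) powr \<alpha> * z"
      proof -
        have "z = (2 * ?n) powr (- \<alpha>) * g powr (- \<alpha>)" unfolding z_def using g by (subst powr_mult) auto
        then have "(2 * ?n) powr \<alpha> * z = g powr (- \<alpha>)" by (simp add: powr_add[symmetric] mult.assoc[symmetric])
        then show ?thesis by (simp add: mult.assoc)
      qed
      also have "\<dots> \<le> ?C * z"
      proof (rule mult_right_mono)
        have "1 \<le> 2 * ?n" using n1 by linarith
        with \<alpha>(2) have "(2 * ?n) powr \<alpha> \<le> (2 * ?n) powr 1" by (rule powr_mono)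
        then have "C * (2 * ?n) powr \<alpha> \<le> C * (2 * ?n)" using assms(5) by (intro mult_left_mono) auto
        then show "C * (2 * ?n) powr \<alpha> \<le> ?C" by (simp add: mult.commute)
      qed (simp add: z_def)
      finally have "ennreal (C * g powr (- \<alpha>)) * emeasure lebesgue ?P \<le> ennreal (?C * z) * emeasure lebesgue ?P"
        by (intro mult_right_mono ennreal_leI) auto
      then have "(\<integral>\<^sup>+x\<in>?P. dist_weight E \<alpha> x \<partial>lebesgue) \<le> ennreal (?C * z) * emeasure lebesgue ?P"
        using bound[OF l, of a] unfolding g_def by (rule order_trans[rotated])
      then show ?thesis using lower by (intro exI[of _ z]) (auto simp: z_def)
    qed
    then obtain z where z: "0 \<le> z" "\<And>x. x \<in> ?P \<Longrightarrow> ennreal z \<le> dist_weight E \<alpha> x"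
      "(\<integral>\<^sup>+x\<in>?P. dist_weight E \<alpha> x \<partial>lebesgue) \<le> ennreal (?C * z) * emeasure lebesgue ?P" by blast
    have ess: "ennreal z \<le> ess_inf_on ?P (dist_weight E \<alpha>)"
      unfolding ess_inf_on_def by (rule Sup_upper) (use z(2) in simp)
    have P: "emeasure lebesgue ?P \<noteq> 0" "emeasure lebesgue ?P \<noteq> top"
      using l by (simp_all only: emeasure_cube less_imp_le) simp_all
    have "(\<integral>\<^sup>+x\<in>?P. dist_weight E \<alpha> x \<partial>lebesgue) / emeasure lebesgue ?P
        \<le> ennreal (?C * z) * emeasure lebesgue ?P / emeasure lebesgue ?P"
      by (rule divide_right_mono_ennreal[OF z(3)])
    also have "\<dots> = ennreal (?C * z)" using P by (rule ennreal_mult_divide_eq)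
    also have "\<dots> = ennreal ?C * ennreal z" using z(1) by (intro ennreal_mult) auto
    also have "\<dots> \<le> ennreal ?C * ess_inf_on ?P (dist_weight E \<alpha>)" by (rule mult_left_mono[OF ess]) simp
    finally show ?thesis .
  qed
  then show ?thesis unfolding A1_bound_def is_cube_def by auto
qed

lemma weight_dist_weight:
  fixes E :: "(real^'n) set"
  assumes bound: "\<And>(a :: real^'n) l. 0 < l \<Longrightarrow> (\<integral>\<^sup>+x\<in>cube a l. dist_weight E \<alpha> x \<partial>lebesgue) < \<infinity>"
  shows "weight (dist_weight E \<alpha>)"
  unfolding weight_def
proof (intro conjI allI impI)
  have [measurable]: "(\<lambda>x. infdist x E) \<in> borel_measurable lborel"
    by (simp add: borel_measurable_continuous_onI continuous_on_infdist)
  have "dist_weight E \<alpha> \<in> borel_measurable lborel"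
    unfolding dist_weight_def[abs_def] by measurable
  then show "dist_weight E \<alpha> \<in> borel_measurable lebesgue" by (rule measurable_completion)
  show "AE x in lebesgue. 0 < dist_weight E \<alpha> x"
    using infdist_nonneg[of _ E] by (intro AE_I2) (auto simp: dist_weight_def order_less_le)
  fix K :: "(real^'n) set" assume "compact K"
  then obtain M where M: "\<And>x. x \<in> K \<Longrightarrow> norm x \<le> M" "0 < M"
    using compact_imp_bounded bounded_normE by metis
  have "K \<subseteq> cube (\<chi> i. - M) (2 * M + 1)"
  proof
    fix x assume "x \<in> K"
    then have "\<bar>x $ i\<bar> \<le> M" for i using M(1) component_le_norm_cart[of x i] by (meson order_trans)
    then have "- M \<le> x $ i \<and> x $ i \<le> M" for i by (simp add: abs_le_iff) (metis minus_le_iff)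
    then show "x \<in> cube (\<chi> i. - M) (2 * M + 1)" by (auto simp: cube_def) (smt (verit))
  qed
  then have "(\<integral>\<^sup>+x\<in>K. dist_weight E \<alpha> x \<partial>lebesgue)
      \<le> (\<integral>\<^sup>+x\<in>cube (\<chi> i. - M) (2 * M + 1). dist_weight E \<alpha> x \<partial>lebesgue)"
    by (intro nn_integral_mono mult_left_mono) (auto simp: indicator_def)
  also have "\<dots> < \<infinity>" using M(2) by (intro bound) simp
  finally show "(\<integral>\<^sup>+x\<in>K. dist_weight E \<alpha> x \<partial>lebesgue) < \<infinity>" .
qed

text \<open>
  As \<open>\<alpha>\<close> tends to 0, \<open>\<rho> powr - \<alpha>\<close> tends to 1. With the exponent chosen below, the product is at most the
  square root of q.
\<close>

lemma ex_small_exponent: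
  fixes \<rho> q :: real
  assumes "0 < \<rho>" "\<rho> < 1" "0 < q" "q < 1"
  obtains \<alpha> where "0 < \<alpha>" "\<alpha> < 1" "\<rho> powr (- \<alpha>) * q < 1"
proof -
  define \<alpha> where "\<alpha> = min (1 / 2) (ln q / (2 * ln \<rho>))"
  have l: "ln q < 0" "ln \<rho> < 0" using assms by auto
  then have pos: "0 < \<alpha>" by (auto simp: \<alpha>_def divide_neg_neg)
  have "\<alpha> \<le> ln q / (2 * ln \<rho>)" by (simp add: \<alpha>_def)
  then have "ln q \<le> \<alpha> * (2 * ln \<rho>)" using l(2) by (simp add: neg_le_divide_eq)
  then have "- \<alpha> * ln \<rho> + ln q < 0" using l(1) by linarith
  then have "exp (- \<alpha> * ln \<rho> + ln q) < 1" by simp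
  moreover have "exp (- \<alpha> * ln \<rho> + ln q) = \<rho> powr (- \<alpha>) * q"
    unfolding exp_add powr_def using assms by simp
  ultimately have "\<rho> powr (- \<alpha>) * q < 1" by (simp only:)
  with pos show ?thesis by (intro that[of \<alpha>]) (auto simp: \<alpha>_def)
qed

theorem lemma5p3:
  fixes c \<delta> :: real
  assumes "0 < c" "c < 1" "0 < \<delta>" "\<delta> < 1"
  shows "\<exists>\<alpha> C :: real. 0 < \<alpha> \<and> \<alpha> < 1 \<and> 0 < C \<and>
    (\<forall>E :: (real^'n) set. weakly_porous c \<delta> E \<longrightarrow>
      dist_weight E \<alpha> \<in> A1 \<and> A1_const (dist_weight E \<alpha>) \<le> C)"
proof -
  define \<eta> where "\<eta> = \<delta> / 4"
  have \<eta>: "0 < \<eta>" "\<eta> < 1" using assms by (auto simp: \<eta>_def)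
  obtain \<sigma> where \<sigma>: "0 < \<sigma>" "\<sigma> \<le> 1"
    "\<And>E (a :: real^'n) b l. evenly_porous c \<eta> E \<Longrightarrow> 0 < l \<Longrightarrow> cube a l \<subseteq> cube b (2 * l) \<Longrightarrow>
      \<sigma> * free_side E (cube b (2 * l)) \<le> free_side E (cube a l)"
    using free_side_doubling[OF assms(1) \<eta> assms(2), where 'n = 'n] by metis
  have "\<sigma> * \<eta> \<le> 1 * 1" using \<sigma>(1,2) \<eta> by (intro mult_mono) auto
  then have \<rho>: "0 < \<sigma> * \<eta> / 4" "\<sigma> * \<eta> / 4 < 1" using \<sigma>(1) \<eta>(1) by auto
  obtain \<alpha> where \<alpha>: "0 < \<alpha>" "\<alpha> < 1" "(\<sigma> * \<eta> / 4) powr (- \<alpha>) * (1 - c / 4 ^ CARD('n)) < 1"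
    using ex_small_exponent[OF \<rho> porosity_ratio_bounds[OF assms(1,2)]] by metis
  define \<theta> where "\<theta> = (\<sigma> * \<eta> / 4) powr (- \<alpha>) * (1 - c / 4 ^ CARD('n))"
  define K where "K = (\<eta> / 4) powr (- \<alpha>) / (1 - \<theta>)"
  have K: "0 \<le> K" using \<alpha>(3) by (simp add: K_def \<theta>_def)
  let ?C = "max 3 (2 * real CARD('n) * K)"
  have "dist_weight E \<alpha> \<in> A1 \<and> A1_const (dist_weight E \<alpha>) \<le> ?C"
    if E: "weakly_porous c \<delta> E" for E :: "(real^'n) set"
  proof -
    have porous: "evenly_porous c \<eta> E"
      unfolding \<eta>_def by (rule weakly_porous_imp_evenly_porous[OF E assms(1,3,4)])
    have "E \<noteq> {}" using E by (simp add: weakly_porous_def)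
    then have bound: "(\<integral>\<^sup>+x\<in>cube a l. dist_weight E \<alpha> x \<partial>lebesgue)
        \<le> ennreal (K * free_side E (cube a l) powr (- \<alpha>)) * emeasure lebesgue (cube a l)"
      if "0 < l" for a :: "real^'n" and l
      unfolding K_def
      by (intro dist_weight_integral_le[OF \<alpha>(1)] truncated_integral_le[OF porous assms(1,2) \<eta> _ \<sigma>(1,2)])
         (use \<sigma>(3)[OF porous] \<alpha> that in \<open>auto simp: \<theta>_def\<close>)
    have A: "A1_bound (dist_weight E \<alpha>) ?C"
      by (rule A1_bound_dist_weight[OF porous assms(1) \<alpha>(1) less_imp_le[OF \<alpha>(2)] K bound])
    have "weight (dist_weight E \<alpha>)"
    proof (rule weight_dist_weight)
      fix a :: "real^'n" and l :: real assume l: "0 < l"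
      have "ennreal (K * free_side E (cube a l) powr (- \<alpha>)) * emeasure lebesgue (cube a l) < \<infinity>"
        using l by (simp only: emeasure_cube less_imp_le) (simp add: ennreal_mult_less_top)
      then show "(\<integral>\<^sup>+x\<in>cube a l. dist_weight E \<alpha> x \<partial>lebesgue) < \<infinity>"
        using bound[OF l, of a] by (rule le_less_trans[rotated])
    qed
    moreover have "A1_const (dist_weight E \<alpha>) \<le> ?C"
      unfolding A1_const_def
      by (rule cInf_lower) (use A in \<open>auto simp: A1_bound_def intro!: bdd_belowI[of _ 0]\<close>)
    ultimately show ?thesis using A by (auto simp: A1_def)
  qed
  then show ?thesis using \<alpha>(1,2) by (intro exI[of _ \<alpha>] exI[of _ ?C]) auto
qed

end
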